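(* Let $H$ be an infinite-dimensional separable Hilbert space and let $\varphi$ be a normal state on $B(H)$. Let $f$ be a strictly positive, continuous function on $(0,\infty)$, and let $g$ be the function on $(0,\infty)$ defined by $g(t)=\dfrac{t}{f(t)}$. Suppose that for all positive invertible $A,B\in B(H)$, $$\varphi(A+B)-\varphi(|A-B|)\le 2\varphi\bigl(f(A)^{1/2}g(B)f(A)^{1/2}\bigr).$$ Then the function $g$ is operator monotone on $(0,\infty)$.
   Context: $B(H)$ is the algebra of all bounded operators on the complex Hilbert space $H$; functions of self-adjoint operators are defined by continuous functional calculus, and $|X|=(X^*X)^{1/2}$. A normal state is a functional of the form $\varphi(X)=\operatorname{Tr}(SX)$ for a positive trace-class operator $S$ with $\operatorname{Tr}(S)=1$. A function $g\colon(0,\infty)\to\mathbb{R}$ is operator monotone if for every $k\in\mathbb{N}$ and all self-adjoint $k\times k$ complex matrices $A,B$ with eigenvalues in $(0,\infty)$, $A\le B$ implies $g(A)\le g(B)$, where $X\le Y$ means that $Y-X$ is positive semi-definite. *)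

theory Defs
  imports
    "HOL-Analysis.Analysis"
    "HOL-Library.Complex_Order"
    "Jordan_Normal_Form.Schur_Decomposition"
begin

(* Complex Hilbert spaces.  The inner product is linear in the second argument;
   cinner_self says both that it is positive definite and that it induces the norm. *)

class complex_inner = real_normed_vector +
  fixes scaleC :: "complex \<Rightarrow> 'a \<Rightarrow> 'a"  (infixr "*\<^sub>C" 75)
    and cinner :: "'a \<Rightarrow> 'a \<Rightarrow> complex"
  assumes scaleR_scaleC: "r *\<^sub>R x = complex_of_real r *\<^sub>C x"
    and scaleC_add_right: "a *\<^sub>C (x + y) = a *\<^sub>C x + a *\<^sub>C y"
    and scaleC_add_left: "(a + b) *\<^sub>C x = a *\<^sub>C x + b *\<^sub>C x"
    and scaleC_scaleC: "a *\<^sub>C b *\<^sub>C x = (a * b) *\<^sub>C x"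
    and cinner_commute: "cinner x y = cnj (cinner y x)"
    and cinner_add_right: "cinner x (y + z) = cinner x y + cinner x z"
    and cinner_scaleC_right: "cinner x (a *\<^sub>C y) = a * cinner x y"
    and cinner_self: "cinner x x = complex_of_real ((norm x)\<^sup>2)"

class chilbert_space = complex_inner + complete_space

abbreviation cspan :: "'h::complex_inner set \<Rightarrow> 'h set" where
  "cspan \<equiv> Modules.module.span (*\<^sub>C)"

definition infinite_cdim :: "'h::complex_inner itself \<Rightarrow> bool" where
  "infinite_cdim _ \<longleftrightarrow> \<not> (\<exists>S :: 'h set. finite S \<and> cspan S = UNIV)"

definition is_onb :: "'h::chilbert_space set \<Rightarrow> bool" where
  "is_onb E \<longleftrightarrow>
     (\<forall>x\<in>E. \<forall>y\<in>E. cinner x y = (if x = y then 1 else 0)) \<and> closure (cspan E) = UNIV"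


(* B(H): the type 'h =>_L 'h consists of the bounded real-linear maps, of which
   bounded_ops are the complex-linear ones. *)

definition bounded_ops :: "('h::chilbert_space \<Rightarrow>\<^sub>L 'h) set" where
  "bounded_ops = {T. \<forall>c x. blinfun_apply T (c *\<^sub>C x) = c *\<^sub>C blinfun_apply T x}"

definition op_adjoint :: "('h::chilbert_space \<Rightarrow>\<^sub>L 'h) \<Rightarrow> ('h \<Rightarrow>\<^sub>L 'h)" where
  "op_adjoint T = (THE T'. \<forall>x y. cinner (blinfun_apply T x) y = cinner x (blinfun_apply T' y))"

definition op_invertible :: "('h::chilbert_space \<Rightarrow>\<^sub>L 'h) \<Rightarrow> bool" where
  "op_invertible T \<longleftrightarrow>
     (\<exists>R\<in>bounded_ops. T o\<^sub>L R = id_blinfun \<and> R o\<^sub>L T = id_blinfun)"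

(* The order on complex is that of Complex_Order: 0 \<le> z means that z is real and nonnegative. *)

definition op_positive :: "('h::chilbert_space \<Rightarrow>\<^sub>L 'h) \<Rightarrow> bool" where
  "op_positive T \<longleftrightarrow> T \<in> bounded_ops \<and> (\<forall>x. 0 \<le> cinner x (blinfun_apply T x))"

definition op_spectrum :: "('h::chilbert_space \<Rightarrow>\<^sub>L 'h) \<Rightarrow> complex set" where
  "op_spectrum T = {z. \<not> op_invertible (T - Blinfun (\<lambda>x. z *\<^sub>C x))}"

definition op_poly :: "real poly \<Rightarrow> ('h::chilbert_space \<Rightarrow>\<^sub>L 'h) \<Rightarrow> ('h \<Rightarrow>\<^sub>L 'h)" where
  "op_poly p T = (\<Sum>i\<le>degree p. coeff p i *\<^sub>R (((o\<^sub>L) T) ^^ i) id_blinfun)"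

(* Continuous functional calculus, for self-adjoint T and real f continuous on the spectrum of T:
   f(T) is the norm limit of p_n(T) for real polynomials p_n converging to f uniformly on the
   (real, compact) spectrum.  The values of f off the spectrum are irrelevant. *)

definition cfc :: "(real \<Rightarrow> real) \<Rightarrow> ('h::chilbert_space \<Rightarrow>\<^sub>L 'h) \<Rightarrow> ('h \<Rightarrow>\<^sub>L 'h)" where
  "cfc f T = (THE R. \<exists>p :: nat \<Rightarrow> real poly.
      uniform_limit {t. complex_of_real t \<in> op_spectrum T} (\<lambda>n. poly (p n)) f sequentially \<and>
      (\<lambda>n. op_poly (p n) T) \<longlonglongrightarrow> R)"

definition op_abs :: "('h::chilbert_space \<Rightarrow>\<^sub>L 'h) \<Rightarrow> ('h \<Rightarrow>\<^sub>L 'h)" where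
  "op_abs T = cfc sqrt (op_adjoint T o\<^sub>L T)"

(* Neither trace_class nor, for trace-class T, op_trace depends on the orthonormal basis. *)

definition trace_class :: "('h::chilbert_space \<Rightarrow>\<^sub>L 'h) \<Rightarrow> bool" where
  "trace_class T \<longleftrightarrow> T \<in> bounded_ops \<and>
     (\<exists>E. is_onb E \<and> (\<lambda>e. cinner e (blinfun_apply (op_abs T) e)) summable_on E)"

definition op_trace :: "('h::chilbert_space \<Rightarrow>\<^sub>L 'h) \<Rightarrow> complex" where
  "op_trace T = (\<Sum>\<^sub>\<infinity>e\<in>(SOME E. is_onb E). cinner e (blinfun_apply T e))"

definition normal_state :: "(('h::chilbert_space \<Rightarrow>\<^sub>L 'h) \<Rightarrow> complex) \<Rightarrow> bool" where
  "normal_state \<phi> \<longleftrightarrow>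
     (\<exists>S. op_positive S \<and> trace_class S \<and> op_trace S = 1 \<and>
          (\<forall>X\<in>bounded_ops. \<phi> X = op_trace (S o\<^sub>L X)))"


definition hermitian_mat :: "nat \<Rightarrow> complex mat \<Rightarrow> bool" where
  "hermitian_mat k A \<longleftrightarrow> A \<in> carrier_mat k k \<and> mat_adjoint A = A"

definition mat_le :: "nat \<Rightarrow> complex mat \<Rightarrow> complex mat \<Rightarrow> bool" where
  "mat_le k A B \<longleftrightarrow> A \<in> carrier_mat k k \<and> B \<in> carrier_mat k k \<and>
     (\<forall>v\<in>carrier_vec k. 0 \<le> ((B - A) *\<^sub>v v) \<bullet>c v)"

(* g(A) = U diag(g d_1, ..., g d_k) U* for any diagonalization A = U diag(d_1, ..., d_k) U*
   of the Hermitian matrix A with U unitary; the result does not depend on the choice. *)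

definition mat_fun :: "nat \<Rightarrow> (real \<Rightarrow> real) \<Rightarrow> complex mat \<Rightarrow> complex mat" where
  "mat_fun k g A = (THE B. \<exists>U (d :: nat \<Rightarrow> real).
      U \<in> carrier_mat k k \<and> U * mat_adjoint U = 1\<^sub>m k \<and> mat_adjoint U * U = 1\<^sub>m k \<and>
      A = U * mat_diag k (\<lambda>i. complex_of_real (d i)) * mat_adjoint U \<and>
      B = U * mat_diag k (\<lambda>i. complex_of_real (g (d i))) * mat_adjoint U)"

definition operator_monotone_pos :: "(real \<Rightarrow> real) \<Rightarrow> bool" where
  "operator_monotone_pos g \<longleftrightarrow>
     (\<forall>k A B. hermitian_mat k A \<and> hermitian_mat k B \<and>
        (\<forall>z. eigenvalue A z \<longrightarrow> z \<in> complex_of_real ` {0<..}) \<and>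
        (\<forall>z. eigenvalue B z \<longrightarrow> z \<in> complex_of_real ` {0<..}) \<and>
        mat_le k A B \<longrightarrow> mat_le k (mat_fun k g A) (mat_fun k g B))"

end

theory Submission
  imports Defs "Jordan_Normal_Form.Spectral_Radius"
begin

text \<open>
  When \<^term>\<open>A\<close> and \<^term>\<open>B\<close> are positive invertible operators with \<open>A \<le> B\<close>, then
  \<open>|A - B| = B - A\<close>, and the hypothesis collapses to \<open>0 \<le> \<phi> X\<close> for
  \<open>X = f(A)\<^sup>1\<^sup>/\<^sup>2 g(B) f(A)\<^sup>1\<^sup>/\<^sup>2 - A\<close>.  Since \<open>A = f(A)\<^sup>1\<^sup>/\<^sup>2 g(A) f(A)\<^sup>1\<^sup>/\<^sup>2\<close>, it is
  enough to show that \<open>X\<close> is positive semidefinite: multiplying by \<open>f(A)\<^sup>-\<^sup>1\<^sup>/\<^sup>2\<close> on both sides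
  turns this into \<open>g(A) \<le> g(B)\<close>.  One functional \<open>\<phi>\<close> detects positivity because the
  hypothesis may be applied to every unitary conjugate of the pair \<open>(A, B)\<close>, and because
  the density operator \<open>S\<close> of \<open>\<phi>\<close> is trace class on an infinite-dimensional space.

  In detail, let \<open>A \<le> B\<close> be \<open>k \<times> k\<close> matrices.  Place them on the span of \<open>k\<close> members of an
  orthonormal basis of \<open>H\<close> and let both operators be the identity on the orthogonal
  complement; that part contributes equally to the two sides of the inequality since
  \<open>f(1) g(1) = 1\<close>.  Choose the coordinates in which the matrix of \<open>X\<close> is diagonal, with entries
  \<open>x\<^sub>i\<close>.  The inequality reads \<open>0 \<le> \<Sum> x\<^sub>i s\<^sub>i\<close>, where \<open>s\<^sub>i\<close> are the diagonal entries of \<open>S\<close> at the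
  chosen basis vectors.  As \<open>S\<close> has trace 1, some diagonal entry is strictly positive, and all
  but finitely many are smaller than any given positive bound.  Giving the index of a negative \<open>x\<^sub>i\<close> the
  first kind of basis vector and all other indices the second kind makes the sum negative, so no
  \<open>x\<^sub>i\<close> is negative.

  The operators that occur are scalar off a finite-dimensional subspace.  Their spectrum is
  finite, so the functional calculus reduces to polynomial interpolation (\<open>cfc_dblock\<close>), and the
  trace splits into a matrix part and a scalar part (\<open>op_trace_block\<close>).  On the matrix side the
  essential tool is the spectral theorem (\<open>hermitian_diagonalization\<close>).  The positivity
  inequality in matrix form is \<open>compressed_trace_inequality\<close>.
\<close>

unbundle no vec_syntax and no inner_syntax

section \<open>Adjoints of complex matrices\<close>

lemma dim_mat_adjoint [simp]:
  "dim_row (mat_adjoint A) = dim_col A" "dim_col (mat_adjoint A) = dim_row A"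
  unfolding mat_adjoint_def by auto

lemma index_mat_adjoint [simp]:
  "i < dim_col A \<Longrightarrow> j < dim_row A \<Longrightarrow> mat_adjoint A $$ (i, j) = conjugate (A $$ (j, i))"
  unfolding mat_adjoint_def by (simp add: mat_of_rows_def)

lemma mat_adjoint_carrier [simp]:
  "A \<in> carrier_mat n m \<Longrightarrow> mat_adjoint A \<in> carrier_mat m n"
  by (auto intro: carrier_matI)

lemma mat_adjoint_adjoint [simp]: "mat_adjoint (mat_adjoint A) = A"
  by (rule eq_matI) auto

lemma square_mat_mult_carrier [simp]:
  "A \<in> carrier_mat k k \<Longrightarrow> B \<in> carrier_mat k k \<Longrightarrow> A * B \<in> carrier_mat k k"
  "A \<in> carrier_mat k k \<Longrightarrow> v \<in> carrier_vec k \<Longrightarrow> A *\<^sub>v v \<in> carrier_vec k"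
  by auto

lemma square_mat_mult_zero_vec [simp]:
  "(M :: complex mat) \<in> carrier_mat k k \<Longrightarrow> M *\<^sub>v 0\<^sub>v k = 0\<^sub>v k"
  by (auto intro!: eq_vecI simp: scalar_prod_def)

lemma mat_adjoint_mult:
  assumes "A \<in> carrier_mat n m" "B \<in> carrier_mat m p"
  shows "mat_adjoint (A * B) = mat_adjoint B * mat_adjoint (A :: complex mat)"
  using assms
  by (intro eq_matI) (auto simp: scalar_prod_def sum_conjugate cnj_sum mult.commute intro!: sum.cong)

lemma mat_adjoint_minus:
  assumes "A \<in> carrier_mat n m" "B \<in> carrier_mat n m"
  shows "mat_adjoint (A - B) = mat_adjoint A - mat_adjoint (B :: complex mat)"
  using assms by (intro eq_matI) auto

lemma cscalar_prod_adjoint: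
  assumes "A \<in> carrier_mat n m" "u \<in> carrier_vec m" "v \<in> carrier_vec n"
  shows "(A *\<^sub>v u) \<bullet>c v = u \<bullet>c (mat_adjoint (A :: complex mat) *\<^sub>v v)"
proof -
  have "(A *\<^sub>v u) \<bullet>c v = (\<Sum>i<n. \<Sum>j<m. A $$ (i, j) * u $ j * cnj (v $ i))"
    using assms
    by (auto simp: scalar_prod_def sum_distrib_right atLeast0LessThan intro!: sum.cong)
  also have "\<dots> = (\<Sum>j<m. \<Sum>i<n. A $$ (i, j) * u $ j * cnj (v $ i))"
    by (rule sum.swap)
  also have "\<dots> = u \<bullet>c (mat_adjoint A *\<^sub>v v)"
    using assms
    by (auto simp: scalar_prod_def sum_distrib_left atLeast0LessThan cnj_sum
             intro!: sum.cong)
  finally show ?thesis .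
qed

lemma conj_quadratic_form:
  fixes M Q :: "complex mat"
  assumes "M \<in> carrier_mat k k" "Q \<in> carrier_mat k k" "v \<in> carrier_vec k"
  shows "((mat_adjoint Q * M * Q) *\<^sub>v v) \<bullet>c v = (M *\<^sub>v (Q *\<^sub>v v)) \<bullet>c (Q *\<^sub>v v)"
  using assms cscalar_prod_adjoint[of "mat_adjoint Q" k k "M *\<^sub>v (Q *\<^sub>v v)" v]
  by (simp add: assoc_mult_mat_vec[of _ k k _ k])

lemma conj_minus:
  fixes M N P Q :: "complex mat"
  assumes "M \<in> carrier_mat k k" "N \<in> carrier_mat k k" "P \<in> carrier_mat k k" "Q \<in> carrier_mat k k"
  shows "P * (M - N) * Q = P * M * Q - P * N * Q"
  using assms
  by (simp add: mult_minus_distrib_mat[of _ k k _ k] minus_mult_distrib_mat[of _ k k _ _ k])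

section \<open>Unitary diagonalization of Hermitian matrices\<close>

definition unitary_mat :: "nat \<Rightarrow> complex mat \<Rightarrow> bool" where
  "unitary_mat k U \<longleftrightarrow>
     U \<in> carrier_mat k k \<and> U * mat_adjoint U = 1\<^sub>m k \<and> mat_adjoint U * U = 1\<^sub>m k"

text \<open>Hermitian matrices are handled through their spectral data: for a fixed unitary \<^term>\<open>U\<close>, all
  algebraic operations and functions act on the real diagonal alone.\<close>

definition udiag :: "nat \<Rightarrow> complex mat \<Rightarrow> (nat \<Rightarrow> real) \<Rightarrow> complex mat" where
  "udiag k U d = U * mat_diag k (\<lambda>i. complex_of_real (d i)) * mat_adjoint U"

lemma unitary_matD:
  assumes "unitary_mat k U"
  shows "U \<in> carrier_mat k k" "mat_adjoint U \<in> carrier_mat k k"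
    "U * mat_adjoint U = 1\<^sub>m k" "mat_adjoint U * U = 1\<^sub>m k"
  using assms unfolding unitary_mat_def by auto

lemma unitary_mat_mult:
  assumes "unitary_mat k U" "unitary_mat k V"
  shows "unitary_mat k (U * V)"
proof -
  note U = unitary_matD[OF assms(1)] and V = unitary_matD[OF assms(2)]
  have "U * V * (mat_adjoint V * mat_adjoint U) = U * (V * mat_adjoint V) * mat_adjoint U"
    using U(1,2) V(1,2) by (simp add: assoc_mult_mat[of _ k k _ k _ k])
  also have "\<dots> = 1\<^sub>m k" unfolding V(3) right_mult_one_mat[OF U(1)] by (rule U(3))
  finally have 1: "U * V * mat_adjoint (U * V) = 1\<^sub>m k"
    unfolding mat_adjoint_mult[OF U(1) V(1)] .
  have "mat_adjoint V * mat_adjoint U * (U * V) = mat_adjoint V * (mat_adjoint U * U) * V"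
    using U(1,2) V(1,2) by (simp add: assoc_mult_mat[of _ k k _ k _ k])
  also have "\<dots> = 1\<^sub>m k" unfolding U(4) right_mult_one_mat[OF V(2)] by (rule V(4))
  finally have 2: "mat_adjoint (U * V) * (U * V) = 1\<^sub>m k"
    unfolding mat_adjoint_mult[OF U(1) V(1)] .
  show ?thesis unfolding unitary_mat_def
    by (intro conjI 1 2 square_mat_mult_carrier U V)
qed

lemma unitary_mat_adjoint: "unitary_mat k U \<Longrightarrow> unitary_mat k (mat_adjoint U)"
  unfolding unitary_mat_def by simp

lemma udiag_carrier [simp]: "unitary_mat k U \<Longrightarrow> udiag k U d \<in> carrier_mat k k"
  unfolding udiag_def by (simp add: unitary_matD)

lemma udiag_cong: "(\<And>i. i < k \<Longrightarrow> d i = e i) \<Longrightarrow> udiag k U d = udiag k U e"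
  unfolding udiag_def mat_diag_def by (rule arg_cong[where f = "\<lambda>X. U * X * mat_adjoint U"]) auto

lemma udiag_one: "unitary_mat k U \<Longrightarrow> udiag k U (\<lambda>_. 1) = 1\<^sub>m k"
  unfolding udiag_def by (simp add: unitary_matD right_mult_one_mat[of _ k k])

lemma udiag_mult:
  assumes "unitary_mat k U"
  shows "udiag k U d * udiag k U e = udiag k U (\<lambda>i. d i * e i)"
proof -
  note U = unitary_matD[OF assms]
  let ?D = "\<lambda>d. mat_diag k (\<lambda>i. complex_of_real (d i))"
  have "udiag k U d * udiag k U e = U * (?D d * ((mat_adjoint U * U) * (?D e * mat_adjoint U)))"
    using U(1,2) unfolding udiag_def by (simp add: assoc_mult_mat[of _ k k _ k _ k])
  also have "\<dots> = U * (?D d * ?D e) * mat_adjoint U"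
    using U(1,2) unfolding U(4)
    by (simp add: assoc_mult_mat[of _ k k _ k _ k] left_mult_one_mat[of _ k k] del: mat_diag_diag)
  finally show ?thesis unfolding udiag_def by simp
qed

lemma mat_adjoint_diag_real [simp]:
  "mat_adjoint (mat_diag k (\<lambda>i. complex_of_real (d i))) = mat_diag k (\<lambda>i. complex_of_real (d i))"
  by (rule eq_matI) (auto simp: mat_diag_def)

lemma udiag_adjoint:
  assumes "unitary_mat k U"
  shows "mat_adjoint (udiag k U d) = udiag k U d"
  using unitary_matD[OF assms] unfolding udiag_def
  by (simp add: mat_adjoint_mult[of _ k k _ k] assoc_mult_mat[of _ k k _ k _ k])

lemma udiag_unitary_conj:
  assumes "unitary_mat k U" "unitary_mat k V"
  shows "V * udiag k U d * mat_adjoint V = udiag k (V * U) d"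
  using unitary_matD[OF assms(1)] unitary_matD[OF assms(2)] unfolding udiag_def
  by (simp add: mat_adjoint_mult[of _ k k _ k] assoc_mult_mat[of _ k k _ k _ k])

lemma udiag_add:
  assumes "unitary_mat k U"
  shows "udiag k U d + udiag k U e = udiag k U (\<lambda>i. d i + e i)"
proof -
  note Us = unitary_matD[OF assms]
  let ?D = "\<lambda>d. mat_diag k (\<lambda>i. complex_of_real (d i))"
  have "?D (\<lambda>i. d i + e i) = ?D d + ?D e" by (rule eq_matI) (auto simp: mat_diag_def)
  thus ?thesis unfolding udiag_def using Us(1,2)
    by (simp add: mult_add_distrib_mat[of _ k k _ k] add_mult_distrib_mat[of _ k k _ _ k])
qed

lemma udiag_scale:
  assumes "unitary_mat k U"
  shows "complex_of_real r \<cdot>\<^sub>m udiag k U d = udiag k U (\<lambda>i. r * d i)"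
proof -
  note Us = unitary_matD[OF assms]
  let ?D = "\<lambda>d. mat_diag k (\<lambda>i. complex_of_real (d i))"
  have "?D (\<lambda>i. r * d i) = complex_of_real r \<cdot>\<^sub>m ?D d" by (rule eq_matI) (auto simp: mat_diag_def)
  thus ?thesis unfolding udiag_def using Us(1,2)
    by (simp add: mult_smult_distrib[of _ k k _ k] mult_smult_assoc_mat[of _ k k _ k])
qed

lemma unitary_conj_mult:
  assumes Q: "unitary_mat k Q" and "M \<in> carrier_mat k k" "N \<in> carrier_mat k k"
  shows "(mat_adjoint Q * M * Q) * (mat_adjoint Q * N * Q) = mat_adjoint Q * (M * N) * Q"
proof -
  note Qs = unitary_matD[OF Q]
  have "(mat_adjoint Q * M * Q) * (mat_adjoint Q * N * Q)
      = mat_adjoint Q * M * (Q * mat_adjoint Q) * N * Q"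
    using Qs(1,2) assms(2,3) by (simp add: assoc_mult_mat[of _ k k _ k _ k])
  thus ?thesis using Qs(1,2) assms(2,3) unfolding Qs(3)
    by (simp add: assoc_mult_mat[of _ k k _ k _ k] right_mult_one_mat[of _ k k])
qed

lemma udiag_conj_self:
  assumes Q: "unitary_mat k Q"
  shows "mat_adjoint Q * udiag k Q x * Q = mat_diag k (\<lambda>i. complex_of_real (x i))"
proof -
  note Qs = unitary_matD[OF Q]
  have "mat_adjoint Q * udiag k Q x * Q
      = (mat_adjoint Q * Q) * mat_diag k (\<lambda>i. complex_of_real (x i)) * (mat_adjoint Q * Q)"
    unfolding udiag_def using Qs(1,2) by (simp add: assoc_mult_mat[of _ k k _ k _ k])
  thus ?thesis unfolding Qs(4)
    by (simp add: right_mult_one_mat[of _ k k] left_mult_one_mat[of _ k k])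
qed

lemma udiag_intertwine:
  assumes "unitary_mat k U" shows "udiag k U d * U = U * mat_diag k (\<lambda>i. complex_of_real (d i))"
  using unitary_matD[OF assms] unfolding udiag_def
  by (simp add: assoc_mult_mat[of _ k k _ k _ k] right_mult_one_mat[of _ k k])

text \<open>The unitary \<open>W = V\<^sup>* U\<close> intertwines the two diagonal matrices, so its entry \<open>(i, j)\<close> vanishes
  unless \<^term>\<open>e i = d j\<close>.  Hence it intertwines their images under \<^term>\<open>g\<close> too.  This makes functions
  of a Hermitian matrix well defined.\<close>

lemma udiag_fun_unique:
  assumes U: "unitary_mat k U" and V: "unitary_mat k V"
    and eq: "udiag k U d = udiag k V e"
  shows "udiag k U (\<lambda>i. g (d i)) = udiag k V (\<lambda>i. g (e i))"
proof -
  note Us = unitary_matD[OF U] and Vs = unitary_matD[OF V]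
  define W where "W = mat_adjoint V * U"
  have W: "W \<in> carrier_mat k k" unfolding W_def using Us Vs by auto
  let ?D = "\<lambda>d. mat_diag k (\<lambda>i. complex_of_real (d i))"
  have "?D e * W = mat_adjoint V * (udiag k V e * U)"
  proof -
    have "mat_adjoint V * (udiag k V e * U) = (mat_adjoint V * V) * (?D e * (mat_adjoint V * U))"
      using Us(1,2) Vs(1,2) unfolding udiag_def
      by (simp add: assoc_mult_mat[of _ k k _ k _ k])
    thus ?thesis using W by (simp add: Vs W_def left_mult_one_mat[of _ k k])
  qed
  also have "\<dots> = W * ?D d"
    unfolding eq[symmetric] udiag_intertwine[OF U] W_def using Us(1,2) Vs(1,2)
    by (simp add: assoc_mult_mat[of _ k k _ k _ k])
  finally have intertw: "?D e * W = W * ?D d" .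
  have "?D (\<lambda>i. g (e i)) * W = W * ?D (\<lambda>i. g (d i))"
  proof (rule eq_matI)
    fix i j
    assume "i < dim_row (W * ?D (\<lambda>i. g (d i)))" "j < dim_col (W * ?D (\<lambda>i. g (d i)))"
    hence ij: "i < k" "j < k" using W by (auto simp: mat_diag_def)
    have "complex_of_real (e i) * W $$ (i, j) = W $$ (i, j) * complex_of_real (d j)"
      using arg_cong[OF intertw, of "\<lambda>X. X $$ (i, j)"] W ij
      by (simp add: mat_diag_mult_left[OF W] mat_diag_mult_right[OF W])
    hence "W $$ (i, j) = 0 \<or> e i = d j" by simp
    thus "(?D (\<lambda>i. g (e i)) * W) $$ (i, j) = (W * ?D (\<lambda>i. g (d i))) $$ (i, j)"
      using ij by (auto simp: mat_diag_mult_left[OF W] mat_diag_mult_right[OF W])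
  qed (use W in \<open>auto simp: mat_diag_def\<close>)
  hence "V * (?D (\<lambda>i. g (e i)) * W) * mat_adjoint U = V * (W * ?D (\<lambda>i. g (d i))) * mat_adjoint U"
    by simp
  moreover have "V * (?D (\<lambda>i. g (e i)) * W) * mat_adjoint U
      = V * ?D (\<lambda>i. g (e i)) * mat_adjoint V * (U * mat_adjoint U)"
    using Us(1,2) Vs(1,2) unfolding W_def by (simp add: assoc_mult_mat[of _ k k _ k _ k])
  moreover have "V * (W * ?D (\<lambda>i. g (d i))) * mat_adjoint U
      = (V * mat_adjoint V) * (U * ?D (\<lambda>i. g (d i)) * mat_adjoint U)"
    using Us(1,2) Vs(1,2) unfolding W_def by (simp add: assoc_mult_mat[of _ k k _ k _ k])
  ultimately show ?thesis
    using Us Vs unfolding udiag_def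
    by (simp add: left_mult_one_mat[of _ k k] right_mult_one_mat[of _ k k])
qed

lemma mat_fun_udiag:
  assumes U: "unitary_mat k U"
  shows "mat_fun k g (udiag k U d) = udiag k U (\<lambda>i. g (d i))"
  unfolding mat_fun_def
proof (rule the_equality)
  show "\<exists>V e. V \<in> carrier_mat k k \<and> V * mat_adjoint V = 1\<^sub>m k \<and> mat_adjoint V * V = 1\<^sub>m k \<and>
      udiag k U d = V * mat_diag k (\<lambda>i. complex_of_real (e i)) * mat_adjoint V \<and>
      udiag k U (\<lambda>i. g (d i)) = V * mat_diag k (\<lambda>i. complex_of_real (g (e i))) * mat_adjoint V"
    using U unfolding unitary_mat_def udiag_def by blast
next
  fix B
  assume "\<exists>V e. V \<in> carrier_mat k k \<and> V * mat_adjoint V = 1\<^sub>m k \<and> mat_adjoint V * V = 1\<^sub>m k \<and>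
      udiag k U d = V * mat_diag k (\<lambda>i. complex_of_real (e i)) * mat_adjoint V \<and>
      B = V * mat_diag k (\<lambda>i. complex_of_real (g (e i))) * mat_adjoint V"
  then obtain V e where "unitary_mat k V" "udiag k U d = udiag k V e"
    "B = udiag k V (\<lambda>i. g (e i))"
    unfolding unitary_mat_def udiag_def by blast
  thus "B = udiag k U (\<lambda>i. g (d i))" using udiag_fun_unique[OF U] by metis
qed

lemma diag_quadratic_form:
  assumes "v \<in> carrier_vec k"
  shows "(mat_diag k (\<lambda>i. complex_of_real (d i)) *\<^sub>v v) \<bullet>c v
    = (\<Sum>i<k. complex_of_real (d i * (cmod (v $ i))\<^sup>2))"
proof -
  have "(mat_diag k (\<lambda>i. complex_of_real (d i)) *\<^sub>v v) $ i = complex_of_real (d i) * v $ i"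
    if "i < k" for i
  proof -
    have "(mat_diag k (\<lambda>i. complex_of_real (d i)) *\<^sub>v v) $ i
        = (\<Sum>j<k. (if j = i then complex_of_real (d j) * v $ j else 0))"
      using that assms
      by (auto simp: mat_diag_def scalar_prod_def atLeast0LessThan intro!: sum.cong simp del: sum.delta sum.delta')
    also have "\<dots> = complex_of_real (d i) * v $ i" using that by simp
    finally show ?thesis .
  qed
  thus ?thesis using assms
    by (auto simp: scalar_prod_def atLeast0LessThan mult.assoc complex_norm_square[symmetric]
             intro!: sum.cong)
qed

lemma udiag_quadratic_form:
  assumes U: "unitary_mat k U" and v: "v \<in> carrier_vec k"
  shows "(udiag k U d *\<^sub>v v) \<bullet>c v
    = (\<Sum>i<k. complex_of_real (d i * (cmod ((mat_adjoint U *\<^sub>v v) $ i))\<^sup>2))"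
proof -
  note Us = unitary_matD[OF U]
  let ?D = "mat_diag k (\<lambda>i. complex_of_real (d i))" and ?u = "mat_adjoint U *\<^sub>v v"
  have u: "?u \<in> carrier_vec k" using Us v by simp
  have "(udiag k U d *\<^sub>v v) \<bullet>c v = (U *\<^sub>v (?D *\<^sub>v ?u)) \<bullet>c v"
    unfolding udiag_def using Us v by (simp add: assoc_mult_mat_vec[of _ k k _ k])
  also have "\<dots> = (?D *\<^sub>v ?u) \<bullet>c ?u"
    using Us v by (intro cscalar_prod_adjoint[of _ k k]) auto
  finally show ?thesis unfolding diag_quadratic_form[OF u] .
qed

lemma udiag_psd:
  assumes "unitary_mat k U" "v \<in> carrier_vec k" "\<And>i. i < k \<Longrightarrow> 0 \<le> d i"
  shows "0 \<le> (udiag k U d *\<^sub>v v) \<bullet>c v"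
  unfolding udiag_quadratic_form[OF assms(1,2)] using assms(3)
  by (intro sum_nonneg) (auto simp: less_eq_complex_def)

lemma udiag_col:
  assumes U: "unitary_mat k U" and i: "i < k"
  shows "udiag k U d *\<^sub>v col U i = complex_of_real (d i) \<cdot>\<^sub>v col U i"
    and "mat_adjoint U *\<^sub>v col U i = unit_vec k i"
proof -
  note Us = unitary_matD[OF U]
  have "udiag k U d *\<^sub>v col U i = col (udiag k U d * U) i"
    using Us i by (subst col_mult2[of _ k k _ k]) (auto simp: U)
  also have "\<dots> = complex_of_real (d i) \<cdot>\<^sub>v col U i"
    unfolding udiag_intertwine[OF U] mat_diag_mult_right[OF Us(1)] using Us i
    by (intro eq_vecI) auto
  finally show "udiag k U d *\<^sub>v col U i = complex_of_real (d i) \<cdot>\<^sub>v col U i" .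
  have "mat_adjoint U *\<^sub>v col U i = col (mat_adjoint U * U) i"
    using Us i by (subst col_mult2[of _ k k _ k]) auto
  thus "mat_adjoint U *\<^sub>v col U i = unit_vec k i" using Us i by simp
qed

lemma udiag_eigenvalue:
  assumes U: "unitary_mat k U" and i: "i < k"
  shows "eigenvalue (udiag k U d) (complex_of_real (d i))"
proof -
  note Us = unitary_matD[OF U]
  have "col U i \<noteq> 0\<^sub>v k"
  proof
    assume "col U i = 0\<^sub>v k"
    hence "(mat_adjoint U *\<^sub>v 0\<^sub>v k) $ i = unit_vec k i $ i"
      using udiag_col(2)[OF U i] by simp
    thus False using i Us(1) by (simp add: scalar_prod_def)
  qed
  moreover have "dim_row (udiag k U d) = k" using udiag_carrier[OF U] by blast
  ultimately show ?thesis
    using Us i udiag_col(1)[OF U i, of d] unfolding eigenvalue_def eigenvector_def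
    by (intro exI[of _ "col U i"]) auto
qed

lemma udiag_psd_imp_nonneg:
  assumes U: "unitary_mat k U" and i: "i < k"
    and psd: "\<And>v. v \<in> carrier_vec k \<Longrightarrow> 0 \<le> (udiag k U d *\<^sub>v v) \<bullet>c v"
  shows "0 \<le> d i"
proof -
  have "0 \<le> (udiag k U d *\<^sub>v col U i) \<bullet>c col U i"
    using unitary_matD[OF U] i by (intro psd) auto
  also have "\<dots> = (\<Sum>j<k. if j = i then complex_of_real (d j) else 0)"
    unfolding udiag_quadratic_form[OF U col_carrier_vec[OF i unitary_matD(1)[OF U]]]
      udiag_col(2)[OF U i]
    using i by (intro sum.cong) auto
  finally show ?thesis using i by (simp add: less_eq_complex_def)
qed

text \<open>Gram-Schmidt, started at \<^term>\<open>v\<close>, gives an orthogonal basis of vectors that need not have length 1;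
  dividing each by its length accounts for the factor \<^term>\<open>c\<close>.\<close>

lemma unitary_completion:
  fixes v :: "complex vec"
  assumes v: "v \<in> carrier_vec n" "v \<noteq> 0\<^sub>v n"
  obtains W c where "unitary_mat n W" "col W 0 = c \<cdot>\<^sub>v v"
proof -
  interpret cof_vec_space n "TYPE(complex)" .
  define b where "b = basis_completion v"
  define ws where "ws = gram_schmidt n b"
  note bc = basis_completion[OF v, folded b_def]
  have n: "0 < n"
  proof (rule ccontr)
    assume "\<not> 0 < n"
    hence "v = 0\<^sub>v n" using v(1) by (intro eq_vecI) auto
    thus False using v(2) by simp
  qed
  from bc(6,7) n obtain vs where bv: "b = v # vs" by (cases b) auto
  have ws: "set ws \<subseteq> carrier_vec n" "corthogonal ws" "length ws = n"
    using gram_schmidt_result[OF bc(2,4,5) ws_def] bc(6) by auto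
  have hd: "hd ws = v" using gram_schmidt_hd[OF v(1), of vs] unfolding ws_def bv by simp
  have wi: "ws ! i \<in> carrier_vec n" if "i < n" for i using ws that by auto
  define r where "r i = sqrt (Re (ws ! i \<bullet>c ws ! i))" for i
  have orth: "ws ! j \<bullet>c ws ! i = (if i = j then complex_of_real ((r i)\<^sup>2) else 0)"
    and pos: "r i > 0"
    if ij: "i < n" "j < n" for i j
  proof -
    have ge: "ws ! i \<bullet>c ws ! i \<ge> 0" by (rule conjugate_square_ge_0_vec)
    have ne: "ws ! i \<bullet>c ws ! i \<noteq> 0" using corthogonalD[OF ws(2)] ij ws(3) by simp
    have "Re (ws ! i \<bullet>c ws ! i) > 0" "Im (ws ! i \<bullet>c ws ! i) = 0"
      using ge ne by (auto simp: less_eq_complex_def complex_eq_iff)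
    thus "r i > 0" "ws ! j \<bullet>c ws ! i = (if i = j then complex_of_real ((r i)\<^sup>2) else 0)"
      using corthogonalD[OF ws(2)] ij ws(3) by (auto simp: r_def complex_eq_iff)
  qed
  define W where "W = mat n n (\<lambda>(i, j). (ws ! j) $ i / complex_of_real (r j))"
  have W: "W \<in> carrier_mat n n" unfolding W_def by simp
  have WW: "mat_adjoint W * W = 1\<^sub>m n"
  proof (rule eq_matI)
    fix i j assume "i < dim_row (1\<^sub>m n :: complex mat)" "j < dim_col (1\<^sub>m n :: complex mat)"
    hence ij: "i < n" "j < n" by auto
    have "(mat_adjoint W * W) $$ (i, j)
        = (\<Sum>l<n. cnj ((ws ! i) $ l) / complex_of_real (r i) * ((ws ! j) $ l / complex_of_real (r j)))"
      using ij W by (simp add: scalar_prod_def atLeast0LessThan) (simp add: W_def)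
    also have "\<dots> = (ws ! j \<bullet>c ws ! i) / (complex_of_real (r i) * complex_of_real (r j))"
      using wi[OF ij(1)] wi[OF ij(2)]
      by (simp add: scalar_prod_def atLeast0LessThan sum_divide_distrib mult.commute)
    also have "\<dots> = (if i = j then 1 else 0)"
      using pos[OF ij] pos[OF ij(2,1)] unfolding orth[OF ij] by (simp add: power2_eq_square)
    finally show "(mat_adjoint W * W) $$ (i, j) = 1\<^sub>m n $$ (i, j)" using ij by simp
  qed (use W in auto)
  have "W * mat_adjoint W = 1\<^sub>m n"
    by (rule mat_mult_left_right_inverse[OF mat_adjoint_carrier[OF W] W WW])
  hence "unitary_mat n W" unfolding unitary_mat_def using W WW by (intro conjI)
  moreover have "col W 0 = (1 / complex_of_real (r 0)) \<cdot>\<^sub>v v"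
    using n hd ws(3) v(1) hd_conv_nth[of ws] unfolding W_def by (intro eq_vecI) fastforce+
  ultimately show ?thesis by (rule that)
qed

lemma four_block_diag:
  "four_block_mat (mat 1 1 (\<lambda>_. complex_of_real e)) (0\<^sub>m 1 n) (0\<^sub>m n 1)
     (mat_diag n (\<lambda>i. complex_of_real (d i)))
   = mat_diag (Suc n) (\<lambda>i. complex_of_real (case i of 0 \<Rightarrow> e | Suc j \<Rightarrow> d j))"
  by (rule eq_matI) (auto simp: mat_diag_def split: nat.splits)

lemma block_diagonal_mult:
  fixes A B C D :: "complex mat"
  assumes "A \<in> carrier_mat 1 1" "B \<in> carrier_mat n n" "C \<in> carrier_mat 1 1" "D \<in> carrier_mat n n"
  shows "four_block_mat A (0\<^sub>m 1 n) (0\<^sub>m n 1) B * four_block_mat C (0\<^sub>m 1 n) (0\<^sub>m n 1) D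
    = four_block_mat (A * C) (0\<^sub>m 1 n) (0\<^sub>m n 1) (B * D)"
  using assms
  by (subst mult_four_block_mat[of _ 1 1 _ n _ n _ _ 1 _ n])
    (auto simp: right_add_zero_mat[of _ 1 1] left_add_zero_mat[of _ n n])

text \<open>Conjugation by a unitary whose first column is an eigenvector clears the rest of the first
  column, and the rest of the first row with it because the matrix stays Hermitian.  What remains
  is a Hermitian block of smaller size.\<close>

lemma hermitian_diagonalization:
  assumes "hermitian_mat k A"
  obtains U d where "unitary_mat k U" "A = udiag k U d"
proof -
  have "\<exists>U d. unitary_mat k U \<and> A = udiag k U d"
    using assms
  proof (induction k arbitrary: A)
    case 0
    hence "unitary_mat 0 (1\<^sub>m 0)" "A = udiag 0 (1\<^sub>m 0) (\<lambda>_. 0)"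
      unfolding unitary_mat_def udiag_def hermitian_mat_def by auto
    thus ?case by blast
  next
    case (Suc n)
    let ?m = "Suc n"
    from Suc.prems have A: "A \<in> carrier_mat ?m ?m" and herm: "mat_adjoint A = A"
      unfolding hermitian_mat_def by auto
    from spectrum_non_empty[OF A] obtain e where "eigenvalue A e"
      unfolding spectrum_def by auto
    then obtain v where "v \<in> carrier_vec ?m" "v \<noteq> 0\<^sub>v ?m" and Av: "A *\<^sub>v v = e \<cdot>\<^sub>v v"
      using A unfolding eigenvalue_def eigenvector_def by auto
    then obtain W c where W: "unitary_mat ?m W" and c: "col W 0 = c \<cdot>\<^sub>v v"
      and v: "v \<in> carrier_vec ?m"
      by (metis unitary_completion)
    note Ws = unitary_matD[OF W]
    define A' where "A' = mat_adjoint W * A * W"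
    have A': "A' \<in> carrier_mat ?m ?m" unfolding A'_def using A Ws by simp
    have herm': "mat_adjoint A' = A'"
      unfolding A'_def using A Ws(1,2) herm
      by (simp add: mat_adjoint_mult[of _ ?m ?m _ ?m] assoc_mult_mat[of _ ?m ?m _ ?m _ ?m])
    have "A *\<^sub>v col W 0 = e \<cdot>\<^sub>v col W 0"
      unfolding c using A v Av by (simp add: mult_mat_vec[of _ ?m ?m] smult_smult_assoc mult.commute)
    have cW: "col W 0 \<in> carrier_vec ?m" by (rule col_carrier_vec[OF _ Ws(1)]) simp
    hence "col A' 0 = mat_adjoint W *\<^sub>v (A *\<^sub>v col W 0)"
      unfolding A'_def using A Ws(1,2)
      by (simp add: col_mult2[of _ ?m ?m _ ?m] assoc_mult_mat_vec[of _ ?m ?m _ ?m])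
    also have "\<dots> = e \<cdot>\<^sub>v (mat_adjoint W *\<^sub>v col W 0)"
      unfolding \<open>A *\<^sub>v col W 0 = e \<cdot>\<^sub>v col W 0\<close>
      by (rule mult_mat_vec[OF Ws(2) cW])
    also have "mat_adjoint W *\<^sub>v col W 0 = unit_vec ?m 0"
      by (rule udiag_col(2)[OF W]) simp
    finally have col0: "col A' 0 = e \<cdot>\<^sub>v unit_vec ?m 0" .
    have c0: "A' $$ (i, 0) = (if i = 0 then e else 0)" if "i < ?m" for i
      using arg_cong[OF col0, of "\<lambda>x. x $ i"] that A' by (auto simp: unit_vec_def)
    have sym: "A' $$ (i, j) = cnj (A' $$ (j, i))" if "i < ?m" "j < ?m" for i j
      using arg_cong[OF herm', of "\<lambda>X. X $$ (i, j)"] that A' by auto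
    have r0: "A' $$ (0, j) = (if j = 0 then e else 0)" if "j < ?m" for j
      using sym[of 0 j] c0[OF that] c0[of 0] that by (cases "j = 0") auto
    have e: "e = complex_of_real (Re e)"
      using sym[of 0 0] c0[of 0] by (simp add: complex_eq_iff)
    define A3 where "A3 = mat n n (\<lambda>(i, j). A' $$ (Suc i, Suc j))"
    have A3: "A3 \<in> carrier_mat n n" unfolding A3_def by simp
    have "mat_adjoint A3 = A3"
    proof (rule eq_matI)
      fix i j assume "i < dim_row A3" "j < dim_col A3"
      thus "mat_adjoint A3 $$ (i, j) = A3 $$ (i, j)"
        using sym[of "Suc i" "Suc j"] unfolding A3_def by simp
    qed (use A3 in auto)
    with Suc.IH[of A3] A3 obtain U d where U: "unitary_mat n U" and A3U: "A3 = udiag n U d"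
      unfolding hermitian_mat_def by blast
    note Us = unitary_matD[OF U]
    let ?z = "0\<^sub>m 1 n :: complex mat" and ?z' = "0\<^sub>m n 1 :: complex mat"
    define F where "F = four_block_mat (1\<^sub>m 1) ?z ?z' U"
    define d' where "d' = (\<lambda>i. case i of 0 \<Rightarrow> Re e | Suc j \<Rightarrow> d j)"
    have adjF: "mat_adjoint F = four_block_mat (1\<^sub>m 1) ?z ?z' (mat_adjoint U)"
      unfolding F_def using Us(1) by (intro eq_matI) auto
    have F: "unitary_mat ?m F"
    proof -
      have "F * mat_adjoint F = 1\<^sub>m ?m" "mat_adjoint F * F = 1\<^sub>m ?m"
        unfolding adjF unfolding F_def
        using Us by (simp_all add: block_diagonal_mult plus_1_eq_Suc del: One_nat_def)
      moreover have "F \<in> carrier_mat ?m ?m"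
        unfolding F_def using Us(1) by auto
      ultimately show ?thesis unfolding unitary_mat_def by (intro conjI)
    qed
    have A'_block: "A' = four_block_mat (mat 1 1 (\<lambda>_. complex_of_real (Re e))) ?z ?z' A3"
    proof (rule eq_matI)
      fix i j
      assume "i < dim_row (four_block_mat (mat 1 1 (\<lambda>_. complex_of_real (Re e))) ?z ?z' A3)"
        and "j < dim_col (four_block_mat (mat 1 1 (\<lambda>_. complex_of_real (Re e))) ?z ?z' A3)"
      hence "i < ?m" "j < ?m" using A3 by auto
      thus "A' $$ (i, j)
          = four_block_mat (mat 1 1 (\<lambda>_. complex_of_real (Re e))) ?z ?z' A3 $$ (i, j)"
        using c0[of i] r0[of j] e A3 by (cases i; cases j) (auto simp: A3_def)
    qed (use A' A3 in auto)
    have FA: "udiag ?m F d' = A'"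
      unfolding udiag_def d'_def four_block_diag[symmetric] adjF A'_block A3U
      unfolding F_def udiag_def
      using Us(1,2)
      by (simp add: block_diagonal_mult right_mult_one_mat[of _ 1 1] left_mult_one_mat[of _ 1 1]
          del: One_nat_def)
    have "udiag ?m (W * F) d' = W * A' * mat_adjoint W"
      unfolding FA[symmetric] by (rule udiag_unitary_conj[OF F W, symmetric])
    also have "\<dots> = (W * mat_adjoint W) * A * (W * mat_adjoint W)"
      unfolding A'_def using A Ws(1,2) by (simp add: assoc_mult_mat[of _ ?m ?m _ ?m _ ?m])
    also have "\<dots> = A"
      unfolding Ws(3) using A by simp
    finally show ?case using unitary_mat_mult[OF W F] by metis
  qed
  thus ?thesis using that by blast
qed

section \<open>Complex inner product spaces\<close>

interpretation complex_module: Modules.module "scaleC :: complex \<Rightarrow> 'a \<Rightarrow> 'a::complex_inner"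
proof
  fix x :: 'a
  have "1 *\<^sub>C x = 1 *\<^sub>R x" by (simp only: scaleR_scaleC of_real_1)
  thus "1 *\<^sub>C x = x" by simp
qed (simp_all add: scaleC_add_right scaleC_add_left scaleC_scaleC)

lemma cinner_add_left: "cinner (x + y) (z :: 'a::complex_inner) = cinner x z + cinner y z"
  by (metis cinner_commute cinner_add_right complex_cnj_add)

lemma cinner_scaleC_left: "cinner (a *\<^sub>C x) (y :: 'a::complex_inner) = cnj a * cinner x y"
  by (metis cinner_commute cinner_scaleC_right complex_cnj_mult)

lemma cinner_zero_right [simp]: "cinner x (0 :: 'a::complex_inner) = 0"
  using cinner_scaleC_right[of x 0 0] by simp

lemma cinner_zero_left [simp]: "cinner (0 :: 'a::complex_inner) x = 0"
  using cinner_scaleC_left[of 0 0 x] by simp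

lemma cinner_diff_right: "cinner x (y - z :: 'a::complex_inner) = cinner x y - cinner x z"
  using cinner_add_right[of x "y - z" z] by simp

lemma cinner_diff_left: "cinner (x - y) (z :: 'a::complex_inner) = cinner x z - cinner y z"
  using cinner_add_left[of "x - y" y z] by simp

lemma cinner_sum_right:
  "cinner x (\<Sum>i\<in>I. f i) = (\<Sum>i\<in>I. cinner (x :: 'a::complex_inner) (f i))"
  by (induction I rule: infinite_finite_induct) (auto simp: cinner_add_right)

lemma cinner_sum_left:
  "cinner (\<Sum>i\<in>I. f i) x = (\<Sum>i\<in>I. cinner (f i) (x :: 'a::complex_inner))"
  by (induction I rule: infinite_finite_induct) (auto simp: cinner_add_left)

lemma cinner_eq_zero_iff: "cinner x x = 0 \<longleftrightarrow> (x :: 'a::complex_inner) = 0"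
  unfolding cinner_self by simp

lemma norm_scaleC: "norm (a *\<^sub>C x :: 'a::complex_inner) = cmod a * norm x"
proof -
  have "complex_of_real ((norm (a *\<^sub>C x))\<^sup>2) = cnj a * a * complex_of_real ((norm x)\<^sup>2)"
    unfolding cinner_self[symmetric] cinner_scaleC_left cinner_scaleC_right by simp
  also have "\<dots> = complex_of_real ((cmod a * norm x)\<^sup>2)"
    by (simp add: power_mult_distrib complex_norm_square[symmetric] mult.commute[of "cnj a"])
  finally have "(norm (a *\<^sub>C x))\<^sup>2 = (cmod a * norm x)\<^sup>2" using of_real_eq_iff by blast
  thus ?thesis by simp
qed

lemma scaleR_scaleC_commute: "a *\<^sub>C r *\<^sub>R x = r *\<^sub>R a *\<^sub>C (x :: 'a::complex_inner)"
  by (simp add: scaleR_scaleC mult.commute)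

lemma bounded_linear_scaleC: "bounded_linear (\<lambda>x. a *\<^sub>C x :: 'a::complex_inner)"
  by (rule bounded_linear_intro[where K = "cmod a"])
    (auto simp: scaleC_add_right scaleR_scaleC_commute norm_scaleC mult.commute)

text \<open>The norm of \<^term>\<open>x\<close> splits by Pythagoras into the component along \<^term>\<open>w\<close> and the rest.\<close>

lemma norm_cinner_le:
  assumes w: "cinner w w = 1"
  shows "cmod (cinner w x) \<le> norm (x :: 'a::complex_inner)"
proof -
  let ?y = "x - cinner w x *\<^sub>C w"
  have "complex_of_real ((norm ?y)\<^sup>2) = cinner x x - cinner w x * cnj (cinner w x)"
    unfolding cinner_self[symmetric]
    by (simp add: cinner_diff_left cinner_diff_right cinner_scaleC_left cinner_scaleC_right w
        cinner_commute[of x w] algebra_simps)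
  also have "\<dots> = complex_of_real ((norm x)\<^sup>2 - (cmod (cinner w x))\<^sup>2)"
    by (simp add: cinner_self complex_norm_square[symmetric])
  finally have "(norm ?y)\<^sup>2 = (norm x)\<^sup>2 - (cmod (cinner w x))\<^sup>2" using of_real_eq_iff by blast
  hence "(cmod (cinner w x))\<^sup>2 \<le> (norm x)\<^sup>2" by (metis diff_ge_0_iff_ge zero_le_power2)
  thus ?thesis by simp
qed

lemma bounded_linear_rank_one:
  assumes w: "cinner w w = 1"
  shows "bounded_linear (\<lambda>x. cinner w x *\<^sub>C (y :: 'a::complex_inner))"
proof (rule bounded_linear_intro[where K = "norm y"])
  show "norm (cinner w x *\<^sub>C y) \<le> norm x * norm y" for x
    unfolding norm_scaleC using norm_cinner_le[OF w] by (intro mult_right_mono) auto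
  show "cinner w (r *\<^sub>R x) *\<^sub>C y = r *\<^sub>R (cinner w x *\<^sub>C y)" for r x
    by (simp add: scaleR_scaleC cinner_scaleC_right)
qed (simp add: cinner_add_right scaleC_add_left)

text \<open>The span of a finite orthonormal set is closed: the remainder \<^term>\<open>z\<close> of a vector after
  projection is orthogonal to the span, so by Pythagoras it is no longer than the distance to any
  member of the span.  A finite orthonormal basis would therefore span the whole space.\<close>

lemma onb_infinite:
  fixes E :: "'h::chilbert_space set"
  assumes E: "is_onb E" and inf: "infinite_cdim TYPE('h)"
  shows "infinite E"
proof
  assume fin: "finite E"
  have orth: "cinner x y = (if x = y then 1 else 0)" if "x \<in> E" "y \<in> E" for x y
    using E that unfolding is_onb_def by blast
  have "x \<in> cspan E" for x
  proof -
    define y where "y = (\<Sum>e\<in>E. cinner e x *\<^sub>C e)"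
    define z where "z = x - y"
    have y: "y \<in> cspan E"
      unfolding y_def
      by (intro complex_module.span_sum complex_module.span_scale complex_module.span_base)
    have perpE: "cinner e z = 0" if "e \<in> E" for e
    proof -
      have "cinner e y = (\<Sum>e'\<in>E. if e = e' then cinner e' x else 0)"
        unfolding y_def cinner_sum_right cinner_scaleC_right
        by (intro sum.cong) (auto simp: orth that)
      also have "\<dots> = cinner e x" using fin that by simp
      finally show ?thesis unfolding z_def cinner_diff_right by simp
    qed
    have perp: "cinner s z = 0" if "s \<in> cspan E" for s
      using that
      by (induction rule: complex_module.span_induct_alt)
        (auto simp: cinner_add_left cinner_scaleC_left perpE)
    \<comment> \<open>The remainder \<^term>\<open>z\<close> is the shortest vector from the span to \<^term>\<open>x\<close>.\<close>
    have near: "norm z \<le> norm (s - x)" if "s \<in> cspan E" for s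
    proof -
      have ys: "y - s \<in> cspan E" by (intro complex_module.span_diff y that)
      have "complex_of_real ((norm (z + (y - s)))\<^sup>2)
          = complex_of_real ((norm z)\<^sup>2 + (norm (y - s))\<^sup>2)"
        unfolding of_real_add cinner_self[symmetric] cinner_add_left cinner_add_right
        using perp[OF ys] cinner_commute[of z "y - s"] by simp
      hence "(norm (z + (y - s)))\<^sup>2 = (norm z)\<^sup>2 + (norm (y - s))\<^sup>2" using of_real_eq_iff by blast
      moreover have "z + (y - s) = x - s" unfolding z_def by simp
      ultimately have "(norm z)\<^sup>2 \<le> (norm (x - s))\<^sup>2" by simp
      thus ?thesis by (simp add: norm_minus_commute)
    qed
    have "norm z \<le> 0 + r" if r: "r > 0" for r
    proof -
      have "x \<in> closure (cspan E)" using E unfolding is_onb_def by simp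
      then obtain s where "s \<in> cspan E" "dist s x < r"
        using r unfolding closure_approachable by blast
      thus ?thesis using near[of s] unfolding dist_norm by simp
    qed
    hence "norm z \<le> 0" by (rule field_le_epsilon)
    hence "x = y" unfolding z_def by simp
    thus ?thesis using y by simp
  qed
  hence "cspan E = UNIV" by blast
  thus False using inf fin unfolding infinite_cdim_def by blast
qed

section \<open>Operators that are scalar off a finite-dimensional subspace\<close>

text \<open>On a finite spectrum every function agrees with a polynomial, which identifies the functional
  calculus there.\<close>

lemma interpolating_polynomial:
  fixes f :: "real \<Rightarrow> real"
  assumes "finite S"
  shows "\<exists>p. \<forall>x\<in>S. poly p x = f x"
  using assms
proof induction
  case (insert a S)
  then obtain p where p: "\<forall>x\<in>S. poly p x = f x" by blast
  define q where "q = (\<Prod>s\<in>S. [:- s, 1:])"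
  have q: "poly q x = (\<Prod>s\<in>S. x - s)" for x unfolding q_def poly_prod by simp
  have "poly q a \<noteq> 0" unfolding q using insert by auto
  moreover have "poly q x = 0" if "x \<in> S" for x unfolding q using that insert by auto
  ultimately have "\<forall>x\<in>insert a S. poly (p + Polynomial.smult ((f a - poly p a) / poly q a) q) x = f x"
    using p by auto
  thus ?case by blast
qed auto

lemma not_invertible_if_kernel:
  assumes "blinfun_apply T x = 0" "x \<noteq> 0"
  shows "\<not> op_invertible (T :: 'h::chilbert_space \<Rightarrow>\<^sub>L 'h)"
proof
  assume "op_invertible T"
  then obtain R where "R o\<^sub>L T = id_blinfun" unfolding op_invertible_def by blast
  from arg_cong[OF this, of "\<lambda>S. blinfun_apply S x"] assms show False by simp
qed

text \<open>The vector orthogonal to the family ensures that the complement of its span is nonzero, so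
  that the scalar by which an operator acts there belongs to the spectrum.\<close>

locale orthonormal_family =
  fixes w :: "nat \<Rightarrow> 'h::chilbert_space" and k :: nat
  assumes orthonormal: "i < k \<Longrightarrow> j < k \<Longrightarrow> cinner (w i) (w j) = (if i = j then 1 else 0)"
    and not_spanning: "\<exists>u. u \<noteq> 0 \<and> (\<forall>i<k. cinner (w i) u = 0)"
begin

definition coords :: "'h \<Rightarrow> complex vec" where
  "coords x = vec k (\<lambda>i. cinner (w i) x)"

definition embed :: "complex vec \<Rightarrow> 'h" where
  "embed v = (\<Sum>i<k. (v $ i) *\<^sub>C w i)"

definition perp :: "'h \<Rightarrow> 'h" where
  "perp x = x - embed (coords x)"

text \<open>The operator with matrix \<^term>\<open>M\<close> on the span of the family and scalar \<^term>\<open>c\<close> on its orthogonal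
  complement.  The maps \<^term>\<open>coords\<close> and \<^term>\<open>perp\<close> split a vector accordingly, and blocks
  act on the two components independently, which makes them closed under the operator algebra.\<close>

definition block :: "complex mat \<Rightarrow> complex \<Rightarrow> 'h \<Rightarrow>\<^sub>L 'h" where
  "block M c = Blinfun (\<lambda>x. embed (M *\<^sub>v coords x) + c *\<^sub>C perp x)"

lemma coords_carrier [simp]: "coords x \<in> carrier_vec k"
  unfolding coords_def by simp

lemma coords_index [simp]: "i < k \<Longrightarrow> coords x $ i = cinner (w i) x"
  unfolding coords_def by simp

lemma dim_coords [simp]: "dim_vec (coords x) = k"
  unfolding coords_def by simp

lemma coords_linear:
  "coords (x + y) = coords x + coords y" "coords (x - y) = coords x - coords y"
  "coords (a *\<^sub>C x) = a \<cdot>\<^sub>v coords x"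
  by (auto intro!: eq_vecI simp: cinner_add_right cinner_diff_right cinner_scaleC_right)

lemma embed_linear:
  "u \<in> carrier_vec k \<Longrightarrow> v \<in> carrier_vec k \<Longrightarrow> embed (u + v) = embed u + embed v"
  "u \<in> carrier_vec k \<Longrightarrow> v \<in> carrier_vec k \<Longrightarrow> embed (u - v) = embed u - embed v"
  "u \<in> carrier_vec k \<Longrightarrow> embed (a \<cdot>\<^sub>v u) = a *\<^sub>C embed u"
  unfolding embed_def
  by (auto simp: complex_module.scale_left_distrib complex_module.scale_left_diff_distrib
      sum.distrib sum_subtractf complex_module.scale_sum_right)

lemma embed_zero [simp]: "embed (0\<^sub>v k) = 0"
  unfolding embed_def by simp

lemma coords_embed [simp]:
  assumes "v \<in> carrier_vec k"
  shows "coords (embed v) = v"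
proof (rule eq_vecI)
  fix i assume "i < dim_vec v"
  hence i: "i < k" using assms by simp
  have "coords (embed v) $ i = (\<Sum>j<k. v $ j * (if i = j then 1 else 0))"
    using i by (simp add: embed_def cinner_sum_right cinner_scaleC_right orthonormal)
  also have "\<dots> = v $ i" using i by (simp add: if_distrib[of "\<lambda>x. _ * x"] cong: if_cong)
  finally show "coords (embed v) $ i = v $ i" .
qed (use assms in simp)

lemma coords_perp [simp]: "coords (perp x) = 0\<^sub>v k"
  unfolding perp_def by (auto intro!: eq_vecI simp: coords_linear)

lemma perp_embed [simp]: "v \<in> carrier_vec k \<Longrightarrow> perp (embed v) = 0"
  unfolding perp_def by simp

lemma perp_perp [simp]: "perp (perp x) = perp x"
  unfolding perp_def[of "perp x"] by simp

lemma perp_linear: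
  "perp (x + y) = perp x + perp y" "perp (a *\<^sub>C x) = a *\<^sub>C perp x"
  unfolding perp_def
  by (auto simp: coords_linear embed_linear complex_module.scale_right_diff_distrib)

lemma embed_plus_perp: "embed (coords x) + perp x = x"
  unfolding perp_def by simp

lemma eq_by_coords_perp: "coords x = coords y \<Longrightarrow> perp x = perp y \<Longrightarrow> x = y"
  by (metis embed_plus_perp)

lemma block_apply:
  assumes M: "M \<in> carrier_mat k k"
  shows "blinfun_apply (block M c) x = embed (M *\<^sub>v coords x) + c *\<^sub>C perp x"
proof -
  have P: "bounded_linear (\<lambda>x. embed (M *\<^sub>v coords x))" if M: "M \<in> carrier_mat k k" for M
  proof -
    have "(\<lambda>x. embed (M *\<^sub>v coords x))
        = (\<lambda>x. \<Sum>i<k. \<Sum>j<k. cinner (w j) x *\<^sub>C M $$ (i, j) *\<^sub>C w i)"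
      using M by (auto simp: embed_def scalar_prod_def atLeast0LessThan fun_eq_iff
          complex_module.scale_sum_left mult.commute intro!: sum.cong)
    moreover have "bounded_linear \<dots>"
      by (intro bounded_linear_sum bounded_linear_rank_one) (simp add: orthonormal)
    ultimately show ?thesis by simp
  qed
  have "bounded_linear (\<lambda>x. c *\<^sub>C perp x)"
    unfolding perp_def using P[of "1\<^sub>m k"]
    by (auto intro!: bounded_linear_compose[OF bounded_linear_scaleC] bounded_linear_sub)
  hence "bounded_linear (\<lambda>x. embed (M *\<^sub>v coords x) + c *\<^sub>C perp x)"
    using P[OF M] by (intro bounded_linear_add) auto
  thus ?thesis unfolding block_def by (simp add: bounded_linear_Blinfun_apply)
qed

lemma
  assumes M: "M \<in> carrier_mat k k"
  shows coords_block: "coords (blinfun_apply (block M c) x) = M *\<^sub>v coords x"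
    and perp_block: "perp (blinfun_apply (block M c) x) = c *\<^sub>C perp x"
  using M by (auto simp: block_apply coords_linear perp_linear intro!: eq_vecI)

lemma block_eqI:
  assumes "M \<in> carrier_mat k k" "\<And>x. coords (blinfun_apply T x) = M *\<^sub>v coords x"
    "\<And>x. perp (blinfun_apply T x) = c *\<^sub>C perp x"
  shows "T = block M c"
  by (rule blinfun_eqI, rule eq_by_coords_perp) (simp_all add: assms coords_block perp_block)

lemma block_mult:
  assumes "M \<in> carrier_mat k k" "N \<in> carrier_mat k k"
  shows "block M c o\<^sub>L block N d = block (M * N) (c * d)"
  using assms
  by (intro block_eqI) (auto simp: coords_block perp_block assoc_mult_mat_vec[of _ k k _ k])

lemma block_add:
  assumes "M \<in> carrier_mat k k" "N \<in> carrier_mat k k"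
  shows "block M c + block N d = block (M + N) (c + d)"
  using assms
  by (intro block_eqI) (auto simp: blinfun.add_left coords_linear perp_linear coords_block
      perp_block scaleC_add_left add_mult_distrib_mat_vec[of _ k k])

lemma block_scaleR:
  assumes "M \<in> carrier_mat k k"
  shows "r *\<^sub>R block M c = block (complex_of_real r \<cdot>\<^sub>m M) (complex_of_real r * c)"
  using assms
  by (intro block_eqI) (auto simp: blinfun.scaleR_left scaleR_scaleC coords_linear perp_linear
      coords_block perp_block intro!: eq_vecI)

lemma block_one: "block (1\<^sub>m k) 1 = id_blinfun"
  by (rule block_eqI[symmetric]) auto

lemma block_in_bounded_ops:
  assumes "M \<in> carrier_mat k k"
  shows "block M c \<in> bounded_ops"
  using assms unfolding bounded_ops_def
  by (auto simp: block_apply coords_linear perp_linear mult_mat_vec[of _ k k] embed_linear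
      scaleC_add_right mult.commute)

lemma cinner_embed_right:
  "v \<in> carrier_vec k \<Longrightarrow> cinner x (embed v) = v \<bullet>c coords x"
  by (auto simp: embed_def cinner_sum_right cinner_scaleC_right scalar_prod_def atLeast0LessThan
      cinner_commute[of x] intro!: sum.cong)

lemma cinner_embed_left:
  "v \<in> carrier_vec k \<Longrightarrow> cinner (embed v) x = coords x \<bullet>c v"
  by (auto simp: embed_def cinner_sum_left cinner_scaleC_left scalar_prod_def atLeast0LessThan
      mult.commute intro!: sum.cong)

lemma cinner_perp: "cinner (perp x) y = cinner x (perp y)"
proof -
  have "cinner (perp x) (embed (coords y)) = 0"
    by (subst cinner_embed_right) (auto simp: scalar_prod_def)
  moreover have "cinner (embed (coords x)) (perp y) = 0"
    by (subst cinner_embed_left) (auto simp: scalar_prod_def)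
  ultimately show ?thesis
    by (metis embed_plus_perp cinner_add_left cinner_add_right add_cancel_right_left)
qed

lemma block_adjoint:
  assumes "M \<in> carrier_mat k k"
  shows "cinner (blinfun_apply (block M c) x) y
    = cinner x (blinfun_apply (block (mat_adjoint M) (cnj c)) y)"
proof -
  have "coords y \<bullet>c (M *\<^sub>v coords x) = (mat_adjoint M *\<^sub>v coords y) \<bullet>c coords x"
    using assms cscalar_prod_adjoint[of "mat_adjoint M" k k "coords y" "coords x"] by simp
  thus ?thesis using assms
    by (simp add: block_apply cinner_add_left cinner_add_right cinner_embed_left
        cinner_embed_right cinner_scaleC_left cinner_scaleC_right cinner_perp)
qed

text \<open>The self-adjoint blocks, given by spectral data.  Every operation on them with a common
  \<^term>\<open>U\<close> is an operation on the eigenvalues.\<close>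

definition dblock :: "complex mat \<Rightarrow> (nat \<Rightarrow> real) \<Rightarrow> real \<Rightarrow> 'h \<Rightarrow>\<^sub>L 'h" where
  "dblock U d c = block (udiag k U d) (complex_of_real c)"

context
  fixes U
  assumes U: "unitary_mat k U"
begin

lemma dblock_mult: "dblock U d c o\<^sub>L dblock U e b = dblock U (\<lambda>i. d i * e i) (c * b)"
  unfolding dblock_def using U by (simp add: block_mult udiag_mult)

lemma dblock_add: "dblock U d c + dblock U e b = dblock U (\<lambda>i. d i + e i) (c + b)"
  unfolding dblock_def using U by (simp add: block_add udiag_add)

lemma dblock_scaleR: "r *\<^sub>R dblock U d c = dblock U (\<lambda>i. r * d i) (r * c)"
  unfolding dblock_def using U by (simp add: block_scaleR udiag_scale)

lemma dblock_one: "dblock U (\<lambda>_. 1) 1 = id_blinfun"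
  unfolding dblock_def using U by (simp add: block_one udiag_one)

lemma dblock_zero: "dblock U (\<lambda>_. 0) 0 = 0"
  using dblock_scaleR[of 0 "\<lambda>_. 0" 0] by simp

lemma dblock_sum:
  "finite I \<Longrightarrow> (\<Sum>j\<in>I. dblock U (d j) (c j)) = dblock U (\<lambda>i. \<Sum>j\<in>I. d j i) (\<Sum>j\<in>I. c j)"
  by (induction I rule: finite_induct) (auto simp: dblock_zero dblock_add)

lemma dblock_cong:
  "(\<And>i. i < k \<Longrightarrow> d i = e i) \<Longrightarrow> c = b \<Longrightarrow> dblock U d c = dblock U e b"
  unfolding dblock_def using udiag_cong by metis

lemma dblock_bounded_ops: "dblock U d c \<in> bounded_ops"
  unfolding dblock_def using U by (simp add: block_in_bounded_ops)

lemma dblock_self_adjoint: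
  "cinner (blinfun_apply (dblock U d c) x) y = cinner x (blinfun_apply (dblock U d c) y)"
  unfolding dblock_def using U block_adjoint[of "udiag k U d" "complex_of_real c" x y]
  by (simp add: udiag_adjoint)

lemma op_adjoint_dblock: "op_adjoint (dblock U d c) = dblock U d c"
  unfolding op_adjoint_def
proof (rule the_equality)
  fix T' :: "'h \<Rightarrow>\<^sub>L 'h"
  assume T': "\<forall>x y. cinner (blinfun_apply (dblock U d c) x) y = cinner x (blinfun_apply T' y)"
  show "T' = dblock U d c"
  proof (rule blinfun_eqI)
    fix y
    let ?z = "blinfun_apply T' y - blinfun_apply (dblock U d c) y"
    have "cinner x ?z = 0" for x
      using T' by (metis cinner_diff_right dblock_self_adjoint right_minus_eq)
    hence "?z = 0" using cinner_eq_zero_iff by blast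
    thus "blinfun_apply T' y = blinfun_apply (dblock U d c) y" by simp
  qed
qed (simp add: dblock_self_adjoint)

lemma dblock_positive:
  assumes "\<And>i. i < k \<Longrightarrow> 0 \<le> d i" "0 \<le> c"
  shows "op_positive (dblock U d c)"
proof -
  let ?R = "dblock U (\<lambda>i. sqrt (d i)) (sqrt c)"
  have "dblock U d c = ?R o\<^sub>L ?R"
    unfolding dblock_mult using assms by (intro dblock_cong) auto
  hence "cinner x (blinfun_apply (dblock U d c) x)
      = complex_of_real ((norm (blinfun_apply ?R x))\<^sup>2)" for x
    unfolding cinner_self[symmetric] by (simp add: dblock_self_adjoint)
  thus ?thesis
    unfolding op_positive_def by (simp add: dblock_bounded_ops less_eq_complex_def)
qed

lemma dblock_invertible:
  assumes "\<And>i. i < k \<Longrightarrow> d i \<noteq> 0" "c \<noteq> 0"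
  shows "op_invertible (dblock U d c)"
proof -
  let ?R = "dblock U (\<lambda>i. 1 / d i) (1 / c)"
  have "dblock U d c o\<^sub>L ?R = id_blinfun" "?R o\<^sub>L dblock U d c = id_blinfun"
    unfolding dblock_mult dblock_one[symmetric] using assms by (auto intro!: dblock_cong)
  thus ?thesis unfolding op_invertible_def using dblock_bounded_ops by blast
qed

lemma dblock_scalar: "Blinfun (\<lambda>x. complex_of_real t *\<^sub>C x) = dblock U (\<lambda>_. t) t"
proof -
  have "Blinfun (\<lambda>x. complex_of_real t *\<^sub>C x) = t *\<^sub>R (id_blinfun :: 'h \<Rightarrow>\<^sub>L 'h)"
    by (rule blinfun_eqI)
      (simp add: bounded_linear_Blinfun_apply[OF bounded_linear_scaleC] scaleR_scaleC
        blinfun.scaleR_left)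
  thus ?thesis unfolding dblock_one[symmetric] dblock_scaleR by simp
qed

lemma dblock_minus_scalar:
  "dblock U d c - Blinfun (\<lambda>x. complex_of_real t *\<^sub>C x) = dblock U (\<lambda>i. d i - t) (c - t)"
proof -
  have "dblock U (\<lambda>i. d i - t) (c - t) + dblock U (\<lambda>_. t) t = dblock U d c"
    unfolding dblock_add by simp
  thus ?thesis unfolding dblock_scalar by (metis add_diff_cancel)
qed

text \<open>Away from the listed values the inverse is again such a block.  At the listed values the
  kernel contains a column of \<^term>\<open>U\<close> or a vector orthogonal to the family.\<close>

lemma dblock_spectrum:
  "{t. complex_of_real t \<in> op_spectrum (dblock U d c)} = insert c (d ` {..<k})"
proof (intro equalityI subsetI)
  fix t assume t: "t \<in> {t. complex_of_real t \<in> op_spectrum (dblock U d c)}"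
  show "t \<in> insert c (d ` {..<k})"
  proof (rule ccontr)
    assume "t \<notin> insert c (d ` {..<k})"
    hence "op_invertible (dblock U (\<lambda>i. d i - t) (c - t))"
      by (intro dblock_invertible) auto
    thus False using t unfolding op_spectrum_def by (simp add: dblock_minus_scalar)
  qed
next
  fix t assume "t \<in> insert c (d ` {..<k})"
  hence "\<exists>x. x \<noteq> 0 \<and> blinfun_apply (dblock U (\<lambda>i. d i - t) (c - t)) x = 0"
  proof
    assume "t = c"
    obtain u where u: "u \<noteq> 0" "\<forall>i<k. cinner (w i) u = 0" using not_spanning by blast
    hence "coords u = 0\<^sub>v k" by (auto intro!: eq_vecI)
    hence "blinfun_apply (dblock U (\<lambda>i. d i - t) (c - t)) u = 0"
      unfolding dblock_def using U \<open>t = c\<close>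
      by (simp add: block_apply)
    with u show ?thesis by blast
  next
    assume "t \<in> d ` {..<k}"
    then obtain i where i: "i < k" "t = d i" by blast
    let ?x = "embed (col U i)"
    have col: "col U i \<in> carrier_vec k" using unitary_matD(1)[OF U] i by simp
    have "?x \<noteq> 0"
    proof
      assume "?x = 0"
      hence "col U i = coords 0" using coords_embed[OF col] by simp
      also have "\<dots> = 0\<^sub>v k" by (auto intro!: eq_vecI)
      finally have "unit_vec k i = mat_adjoint U *\<^sub>v 0\<^sub>v k" using udiag_col(2)[OF U i(1)] by simp
      from arg_cong[OF this, of "\<lambda>v. v $ i"] i unitary_matD(1)[OF U] show False
        by (simp add: scalar_prod_def)
    qed
    moreover have "blinfun_apply (dblock U (\<lambda>i. d i - t) (c - t)) ?x = 0"
      unfolding dblock_def using U i col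
      by (simp add: block_apply udiag_col(1)[OF U i(1)] embed_linear)
    ultimately show ?thesis by blast
  qed
  thus "t \<in> {t. complex_of_real t \<in> op_spectrum (dblock U d c)}"
    unfolding op_spectrum_def using not_invertible_if_kernel by (auto simp: dblock_minus_scalar)
qed

lemma op_poly_dblock:
  "op_poly p (dblock U d c) = dblock U (\<lambda>i. poly p (d i)) (poly p c)"
proof -
  have "(((o\<^sub>L) (dblock U d c)) ^^ n) id_blinfun = dblock U (\<lambda>i. d i ^ n) (c ^ n)" for n
    by (induction n) (simp_all add: dblock_one dblock_mult)
  thus ?thesis unfolding op_poly_def
    by (simp add: dblock_scaleR dblock_sum poly_altdef)
qed

lemma dblock_tendsto:
  assumes "\<And>i. i < k \<Longrightarrow> (\<lambda>n. d n i) \<longlonglongrightarrow> e i" "c \<longlonglongrightarrow> b"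
  shows "(\<lambda>n. dblock U (d n) (c n)) \<longlonglongrightarrow> dblock U e b"
proof -
  \<comment> \<open>Written in terms of fixed operators, with the eigenvalues as coefficients.\<close>
  define E where "E j = dblock U (\<lambda>i. if i = j then 1 else 0) 0" for j
  have expand: "dblock U d c = (\<Sum>j<k. d j *\<^sub>R E j) + c *\<^sub>R dblock U (\<lambda>_. 0) 1" for d c
  proof -
    have "(\<Sum>j<k. d j *\<^sub>R E j) = dblock U (\<lambda>i. \<Sum>j<k. d j * (if i = j then 1 else 0)) 0"
      unfolding E_def by (simp add: dblock_scaleR dblock_sum)
    also have "\<dots> = dblock U d 0"
      by (intro dblock_cong) (simp_all add: if_distrib[of "\<lambda>x. _ * x"] cong: if_cong)
    finally show ?thesis by (simp add: dblock_scaleR dblock_add)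
  qed
  show ?thesis unfolding expand[of "d _"] expand[of e]
    by (intro tendsto_intros assms) auto
qed

text \<open>An interpolating polynomial shows that a limit exists.  It is unique because uniform
  convergence on the spectrum gives convergence of each eigenvalue, and a block depends
  continuously on its finitely many eigenvalues.\<close>

lemma cfc_dblock: "cfc f (dblock U d c) = dblock U (\<lambda>i. f (d i)) (f c)"
  unfolding cfc_def dblock_spectrum
proof (rule the_equality)
  obtain p where p: "\<forall>x\<in>insert c (d ` {..<k}). poly p x = f x"
    using interpolating_polynomial[of "insert c (d ` {..<k})" f] by auto
  have "uniform_limit (insert c (d ` {..<k})) (\<lambda>n. poly p) f sequentially"
    using p by (auto simp: uniform_limit_iff)
  moreover have "op_poly p (dblock U d c) = dblock U (\<lambda>i. f (d i)) (f c)"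
    unfolding op_poly_dblock using p by (intro dblock_cong) auto
  ultimately show "\<exists>p. uniform_limit (insert c (d ` {..<k})) (\<lambda>n. poly (p n)) f sequentially \<and>
      (\<lambda>n. op_poly (p n) (dblock U d c)) \<longlonglongrightarrow> dblock U (\<lambda>i. f (d i)) (f c)"
    by (intro exI[of _ "\<lambda>n. p"]) simp
next
  fix R
  assume "\<exists>p. uniform_limit (insert c (d ` {..<k})) (\<lambda>n. poly (p n)) f sequentially \<and>
      (\<lambda>n. op_poly (p n) (dblock U d c)) \<longlonglongrightarrow> R"
  then obtain p where p: "uniform_limit (insert c (d ` {..<k})) (\<lambda>n. poly (p n)) f sequentially"
    and R: "(\<lambda>n. op_poly (p n) (dblock U d c)) \<longlonglongrightarrow> R" by blast
  have "(\<lambda>n. op_poly (p n) (dblock U d c)) \<longlonglongrightarrow> dblock U (\<lambda>i. f (d i)) (f c)"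
    unfolding op_poly_dblock using tendsto_uniform_limitI[OF p] by (intro dblock_tendsto) auto
  thus "R = dblock U (\<lambda>i. f (d i)) (f c)" using R LIMSEQ_unique by blast
qed

lemma op_abs_dblock: "op_abs (dblock U d c) = dblock U (\<lambda>i. \<bar>d i\<bar>) \<bar>c\<bar>"
  unfolding op_abs_def op_adjoint_dblock dblock_mult cfc_dblock by simp

end

end

section \<open>Traces against a trace-class operator\<close>

context orthonormal_family
begin

text \<open>The trace of the product of \<^term>\<open>M\<close> with the compression of \<^term>\<open>S\<close> to the span of the
  family.\<close>

definition compressed_trace :: "('h \<Rightarrow>\<^sub>L 'h) \<Rightarrow> complex mat \<Rightarrow> complex" where
  "compressed_trace S M = (\<Sum>i<k. cinner (w i) (blinfun_apply S (embed (M *\<^sub>v unit_vec k i))))"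

lemma coords_w: "i < k \<Longrightarrow> coords (w i) = unit_vec k i"
  by (auto intro!: eq_vecI simp: orthonormal)

lemma embed_unit: "i < k \<Longrightarrow> embed (unit_vec k i) = w i"
  unfolding embed_def by (simp add: unit_vec_def if_distrib[of "\<lambda>c. c *\<^sub>C _"] cong: if_cong)

lemma perp_w: "i < k \<Longrightarrow> perp (w i) = 0"
  unfolding perp_def by (simp add: coords_w embed_unit)

lemma compressed_trace_add:
  assumes "M \<in> carrier_mat k k" "N \<in> carrier_mat k k"
  shows "compressed_trace S (M + N) = compressed_trace S M + compressed_trace S N"
  using assms unfolding compressed_trace_def
  by (simp add: add_mult_distrib_mat_vec[of _ k k] embed_linear blinfun.add_right
      cinner_add_right sum.distrib)

lemma compressed_trace_diag:
  assumes S: "S \<in> bounded_ops"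
  shows "compressed_trace S (mat_diag k x) = (\<Sum>i<k. x i * cinner (w i) (blinfun_apply S (w i)))"
  unfolding compressed_trace_def
proof (rule sum.cong)
  fix i assume "i \<in> {..<k}"
  hence i: "i < k" by simp
  have "mat_diag k x *\<^sub>v unit_vec k i = x i \<cdot>\<^sub>v unit_vec k i"
    using i by (auto intro!: eq_vecI simp: mat_diag_def)
  hence "embed (mat_diag k x *\<^sub>v unit_vec k i) = x i *\<^sub>C w i"
    using i by (simp add: embed_linear embed_unit)
  thus "cinner (w i) (blinfun_apply S (embed (mat_diag k x *\<^sub>v unit_vec k i)))
      = x i * cinner (w i) (blinfun_apply S (w i))"
    using S unfolding bounded_ops_def by (simp add: cinner_scaleC_right)
qed simp

text \<open>When the family is taken from the basis that computes the trace, the remaining basis vectors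
  are orthogonal to its span, so the block acts on them as the scalar \<^term>\<open>c\<close>.\<close>

lemma op_trace_block:
  fixes S :: "'h \<Rightarrow>\<^sub>L 'h"
  defines "E \<equiv> SOME E :: 'h set. is_onb E"
  assumes E: "is_onb E" and w: "w ` {..<k} \<subseteq> E" and S: "S \<in> bounded_ops"
    and summable: "(\<lambda>e. cinner e (blinfun_apply S e)) summable_on E"
    and M: "M \<in> carrier_mat k k"
  shows "op_trace (S o\<^sub>L block M c)
    = c * (\<Sum>\<^sub>\<infinity>e\<in>E - w ` {..<k}. cinner e (blinfun_apply S e)) + compressed_trace S M"
proof -
  let ?W = "w ` {..<k}"
  let ?t = "\<lambda>e. cinner e (blinfun_apply (S o\<^sub>L block M c) e)"
  have outside: "?t e = c * cinner e (blinfun_apply S e)" if e: "e \<in> E - ?W" for e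
  proof -
    have "cinner (w i) e = 0" if "i < k" for i
    proof -
      have "w i \<in> E" "w i \<noteq> e" using w e that by auto
      thus ?thesis using E e unfolding is_onb_def by auto
    qed
    hence "coords e = 0\<^sub>v k" by (intro eq_vecI) auto
    hence "blinfun_apply (block M c) e = c *\<^sub>C e"
      unfolding block_apply[OF M] perp_def using M by simp
    thus ?thesis using S unfolding bounded_ops_def by (simp add: cinner_scaleC_right)
  qed
  have inside: "?t (w i) = cinner (w i) (blinfun_apply S (embed (M *\<^sub>v unit_vec k i)))"
    if "i < k" for i
    using that by (simp add: block_apply[OF M] coords_w perp_w)
  have inj: "inj_on w {..<k}"
    using orthonormal by (intro inj_onI) (metis lessThan_iff zero_neq_one)
  have "(\<lambda>e. cinner e (blinfun_apply S e)) summable_on E - ?W"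
    using summable by (rule summable_on_subset_banach) auto
  hence "(\<lambda>e. c * cinner e (blinfun_apply S e)) summable_on E - ?W"
    by (rule summable_on_cmult_right)
  moreover have "?t summable_on E - ?W
      \<longleftrightarrow> (\<lambda>e. c * cinner e (blinfun_apply S e)) summable_on E - ?W"
    by (rule summable_on_cong) (rule outside)
  ultimately have "?t summable_on E - ?W" by blast
  hence "infsum ?t ((E - ?W) \<union> ?W) = infsum ?t (E - ?W) + infsum ?t ?W"
    by (intro infsum_Un_disjoint) auto
  also have "infsum ?t (E - ?W) = c * (\<Sum>\<^sub>\<infinity>e\<in>E - ?W. cinner e (blinfun_apply S e))"
    by (subst infsum_cong[OF outside]) (auto simp: infsum_cmult_right')
  also have "infsum ?t ?W = compressed_trace S M"
    unfolding compressed_trace_def using inside by (simp add: sum.reindex[OF inj])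
  also have "(E - ?W) \<union> ?W = E" using w by blast
  finally show ?thesis unfolding op_trace_def E_def .
qed

end

section \<open>From the trace inequality to operator monotonicity\<close>

text \<open>Infinitely many terms of size at least \<^term>\<open>r\<close> would have finite partial sums beyond any
  bound.\<close>

lemma finite_large_terms:
  fixes s :: "'a \<Rightarrow> real"
  assumes sum: "s summable_on E" and nonneg: "\<And>e. e \<in> E \<Longrightarrow> 0 \<le> s e" and "0 < r"
  shows "finite {e \<in> E. r \<le> s e}"
proof (rule ccontr)
  assume inf: "infinite {e \<in> E. r \<le> s e}"
  obtain n :: nat where n: "infsum s E < real n * r" using ex_less_of_nat_mult[OF \<open>0 < r\<close>] by blast
  obtain F where F: "F \<subseteq> {e \<in> E. r \<le> s e}" "finite F" "card F = n"
    using infinite_arbitrarily_large[OF inf] by blast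
  have "real n * r \<le> sum s F" using sum_bounded_below[of F r s] F by auto
  also have "\<dots> \<le> infsum s E" using F nonneg by (intro finite_sum_le_infsum sum) auto
  finally show False using n by simp
qed

text \<open>The assumed operator inequality, applied to the blocks of two matrices with
  scalar part 1.  As the difference of the matrices is positive semidefinite, the absolute value
  on the left is the difference itself, which leaves twice the smaller operator.  The scalar
  parts cancel because \<open>f(1) g(1) = 1\<close>.\<close>

lemma (in orthonormal_family) compressed_trace_inequality:
  fixes S :: "'h \<Rightarrow>\<^sub>L 'h" and \<phi> :: "('h \<Rightarrow>\<^sub>L 'h) \<Rightarrow> complex" and f g :: "real \<Rightarrow> real"
  defines "E \<equiv> SOME E :: 'h set. is_onb E"
  assumes E: "is_onb E" and w: "w ` {..<k} \<subseteq> E" and S: "S \<in> bounded_ops"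
    and summable: "(\<lambda>e. cinner e (blinfun_apply S e)) summable_on E"
    and \<phi>: "\<And>X. X \<in> bounded_ops \<Longrightarrow> \<phi> X = op_trace (S o\<^sub>L X)"
    and f: "\<And>t. t > 0 \<Longrightarrow> f t > 0" and g: "\<And>t. t > 0 \<Longrightarrow> g t = t / f t"
    and ineq: "\<And>A B :: 'h \<Rightarrow>\<^sub>L 'h.
           op_positive A \<Longrightarrow> op_invertible A \<Longrightarrow> op_positive B \<Longrightarrow> op_invertible B \<Longrightarrow>
           Re (\<phi> (A + B)) - Re (\<phi> (op_abs (A - B)))
             \<le> 2 * Re (\<phi> (cfc sqrt (cfc f A) o\<^sub>L cfc g B o\<^sub>L cfc sqrt (cfc f A)))"
    and U: "unitary_mat k U" and V: "unitary_mat k V"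
    and a: "\<And>i. i < k \<Longrightarrow> a i > 0" and b: "\<And>i. i < k \<Longrightarrow> b i > 0"
    and psd: "\<And>v. v \<in> carrier_vec k \<Longrightarrow> 0 \<le> ((udiag k V b - udiag k U a) *\<^sub>v v) \<bullet>c v"
  defines "C \<equiv> udiag k U (\<lambda>i. sqrt (f (a i)))"
  shows "0 \<le> Re (compressed_trace S (C * udiag k V (\<lambda>i. g (b i)) * C - udiag k U a))"
proof -
  let ?A0 = "udiag k U a" and ?B0 = "udiag k V b"
  define G where "G = udiag k V (\<lambda>i. g (b i))"
  have carr: "?A0 \<in> carrier_mat k k" "?B0 \<in> carrier_mat k k" "C \<in> carrier_mat k k"
    "G \<in> carrier_mat k k"
    unfolding C_def G_def using U V by simp_all
  have "hermitian_mat k (?B0 - ?A0)"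
    unfolding hermitian_mat_def using carr U V
    by (simp add: mat_adjoint_minus[of _ k k] udiag_adjoint minus_carrier_mat)
  then obtain P e where P: "unitary_mat k P" and e: "?B0 - ?A0 = udiag k P e"
    by (rule hermitian_diagonalization)
  have e_nonneg: "0 \<le> e i" if "i < k" for i
    using udiag_psd_imp_nonneg[OF P that] psd unfolding e by blast
  define A where "A = dblock U a 1"
  define B where "B = dblock V b 1"
  define D where "D = dblock P e 0"
  have Pe: "udiag k P e \<in> carrier_mat k k" using P by simp
  have BA: "udiag k P e + ?A0 = ?B0" unfolding e[symmetric] using carr by (intro eq_matI) auto
  have "D + A = B"
    unfolding A_def B_def D_def dblock_def using carr Pe BA by (simp add: block_add)
  hence "A - B = (-1) *\<^sub>R D" by (metis add_diff_cancel minus_diff_eq scaleR_minus1_left)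
  also have "\<dots> = dblock P (\<lambda>i. - e i) 0" unfolding D_def dblock_scaleR[OF P] by simp
  finally have abs: "op_abs (A - B) = D"
    unfolding D_def by (simp add: op_abs_dblock[OF P]) (intro dblock_cong[OF P], use e_nonneg in auto)
  \<comment> \<open>The scalar part of the right-hand operator.\<close>
  have sq: "sqrt (f 1) * g 1 * sqrt (f 1) = 1"
    using f[of 1] g[of 1] by simp
  have rhs: "cfc sqrt (cfc f A) o\<^sub>L cfc g B o\<^sub>L cfc sqrt (cfc f A) = block (C * G * C) 1"
    unfolding A_def B_def cfc_dblock[OF U] cfc_dblock[OF V]
    using carr sq unfolding dblock_def C_def[symmetric] G_def[symmetric]
    by (simp add: block_mult flip: of_real_mult)
  have sum: "A + B = block (?A0 + ?B0) 2"
    unfolding A_def B_def dblock_def using carr by (simp add: block_add)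
  define R where "R = (\<Sum>\<^sub>\<infinity>e\<in>E - w ` {..<k}. cinner e (blinfun_apply S e))"
  let ?F = "compressed_trace S"
  have \<phi>_block: "\<phi> (block M c) = c * R + ?F M" if "M \<in> carrier_mat k k" for M c
    using op_trace_block[of S M c] E w S summable that \<phi>[OF block_in_bounded_ops[OF that]]
    unfolding R_def E_def by simp
  have "Re (\<phi> (A + B)) - Re (\<phi> (op_abs (A - B)))
      \<le> 2 * Re (\<phi> (cfc sqrt (cfc f A) o\<^sub>L cfc g B o\<^sub>L cfc sqrt (cfc f A)))"
    unfolding A_def B_def
    by (intro ineq dblock_positive dblock_invertible U V) (use a b in \<open>force intro: less_imp_le\<close>)+
  hence main: "2 * Re R + Re (?F (?A0 + ?B0)) - Re (?F (udiag k P e)) \<le> 2 * (Re R + Re (?F (C * G * C)))"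
    unfolding abs sum rhs D_def dblock_def using carr Pe by (simp add: \<phi>_block)
  have "?F ?B0 = ?F (udiag k P e) + ?F ?A0"
    unfolding BA[symmetric] using carr Pe by (intro compressed_trace_add) auto
  moreover have "?F (?A0 + ?B0) = ?F ?A0 + ?F ?B0"
    using carr by (intro compressed_trace_add) auto
  moreover have "?F (C * G * C) = ?F (C * G * C - ?A0) + ?F ?A0"
  proof -
    have "C * G * C = (C * G * C - ?A0) + ?A0" using carr by (intro eq_matI) auto
    thus ?thesis using compressed_trace_add[of "C * G * C - ?A0" ?A0 S] carr
      by (metis minus_carrier_mat)
  qed
  ultimately show ?thesis using main unfolding G_def by simp
qed

theorem theorem4p2:
  fixes \<phi> :: "('h::chilbert_space \<Rightarrow>\<^sub>L 'h) \<Rightarrow> complex"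
    and f g :: "real \<Rightarrow> real"
  assumes "infinite_cdim TYPE('h)"
    and "separable_space (euclidean :: 'h topology)"
    and "normal_state \<phi>"
    and "\<And>t. t > 0 \<Longrightarrow> f t > 0"
    and "continuous_on {0<..} f"
    and "\<And>t. t > 0 \<Longrightarrow> g t = t / f t"
    and "\<And>A B :: 'h \<Rightarrow>\<^sub>L 'h.
           op_positive A \<Longrightarrow> op_invertible A \<Longrightarrow> op_positive B \<Longrightarrow> op_invertible B \<Longrightarrow>
           Re (\<phi> (A + B)) - Re (\<phi> (op_abs (A - B)))
             \<le> 2 * Re (\<phi> (cfc sqrt (cfc f A) o\<^sub>L cfc g B o\<^sub>L cfc sqrt (cfc f A)))"
  shows "operator_monotone_pos g"
proof -
  note f = assms(4) and g = assms(6) and ineq = assms(7)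
  obtain S :: "'h \<Rightarrow>\<^sub>L 'h" where S_pos: "op_positive S" and S_tc: "trace_class S"
    and S_tr: "op_trace S = 1" and \<phi>: "\<And>X. X \<in> bounded_ops \<Longrightarrow> \<phi> X = op_trace (S o\<^sub>L X)"
    using assms(3) unfolding normal_state_def by blast
  have S: "S \<in> bounded_ops" using S_pos unfolding op_positive_def by blast
  define E where "E = (SOME E :: 'h set. is_onb E)"
  have E: "is_onb E"
    unfolding E_def using S_tc unfolding trace_class_def by (intro someI_ex[of is_onb]) blast
  define s where "s e = Re (cinner e (blinfun_apply S e))" for e
  have s_nonneg: "0 \<le> s e" and s: "cinner e (blinfun_apply S e) = complex_of_real (s e)" for e
    using S_pos unfolding op_positive_def s_def by (auto simp: less_eq_complex_def complex_eq_iff)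
  have tr: "(\<Sum>\<^sub>\<infinity>e\<in>E. cinner e (blinfun_apply S e)) = 1"
    using S_tr unfolding op_trace_def E_def .
  hence summable: "(\<lambda>e. cinner e (blinfun_apply S e)) summable_on E"
    using infsum_not_exists by fastforce
  have s_summable: "s summable_on E"
    unfolding s_def using summable by (rule summable_on_Re)
  obtain u where u: "u \<in> E" "0 < s u"
  proof (rule ccontr)
    assume "\<not> thesis"
    hence "cinner e (blinfun_apply S e) = 0" if "e \<in> E" for e
      using that s_nonneg[of e] \<open>\<And>u. u \<in> E \<Longrightarrow> 0 < s u \<Longrightarrow> thesis\<close> unfolding s by fastforce
    hence "(\<Sum>\<^sub>\<infinity>e\<in>E. cinner e (blinfun_apply S e)) = 0" by (rule infsum_0)
    thus False using tr by simp
  qed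
  have orth: "cinner x y = (if x = y then 1 else 0)" if "x \<in> E" "y \<in> E" for x y
    using E that unfolding is_onb_def by blast
  show ?thesis
    unfolding operator_monotone_pos_def
  proof (intro allI impI, elim conjE)
    fix k A B
    assume hA: "hermitian_mat k A" and hB: "hermitian_mat k B" and AB: "mat_le k A B"
      and evA: "\<forall>z. eigenvalue A z \<longrightarrow> z \<in> complex_of_real ` {0<..}"
      and evB: "\<forall>z. eigenvalue B z \<longrightarrow> z \<in> complex_of_real ` {0<..}"
    obtain U a where U: "unitary_mat k U" and A: "A = udiag k U a"
      using hA by (rule hermitian_diagonalization)
    obtain V b where V: "unitary_mat k V" and B: "B = udiag k V b"
      using hB by (rule hermitian_diagonalization)
    have a: "a i > 0" if "i < k" for i
      using evA udiag_eigenvalue[OF U that, of a] unfolding A by force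
    have b: "b i > 0" if "i < k" for i
      using evB udiag_eigenvalue[OF V that, of b] unfolding B by force
    define C where "C = udiag k U (\<lambda>i. sqrt (f (a i)))"
    define C' where "C' = udiag k U (\<lambda>i. 1 / sqrt (f (a i)))"
    define G where "G = udiag k V (\<lambda>i. g (b i))"
    define X where "X = C * G * C - A"
    have carr: "A \<in> carrier_mat k k" "B \<in> carrier_mat k k" "C \<in> carrier_mat k k"
      "C' \<in> carrier_mat k k" "G \<in> carrier_mat k k" "X \<in> carrier_mat k k"
      unfolding X_def C_def C'_def G_def A B using U V by (simp_all add: minus_carrier_mat)
    have "hermitian_mat k X"
      unfolding hermitian_mat_def X_def using carr U V
      by (simp add: mat_adjoint_minus[of _ k k] mat_adjoint_mult[of _ k k _ k] minus_carrier_mat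
          assoc_mult_mat[of _ k k _ k _ k]) (simp add: A C_def G_def udiag_adjoint)
    then obtain Q x where Q: "unitary_mat k Q" and X: "X = udiag k Q x"
      by (rule hermitian_diagonalization)
    note Qs = unitary_matD[OF Q]
    let ?Q' = "mat_adjoint Q"
    have Q': "unitary_mat k ?Q'" by (rule unitary_mat_adjoint[OF Q])
    have conj: "udiag k (?Q' * W) d = ?Q' * udiag k W d * Q" if "unitary_mat k W" for W d
      using udiag_unitary_conj[OF that Q'] by simp

    \<comment> \<open>Positivity of \<^term>\<open>X\<close> is tested one eigenvalue at a time.\<close>
    have x_nonneg: "0 \<le> x i0" if i0: "i0 < k" for i0
    proof (rule ccontr)
      assume "\<not> 0 \<le> x i0"
      hence neg: "x i0 < 0" by simp
      \<comment> \<open>The summand 1 keeps \<^term>\<open>N\<close> positive and makes the final estimate strict.\<close>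
      define N where "N = (\<Sum>i<k. \<bar>x i\<bar>) + 1"
      have N: "N > 0" unfolding N_def by (simp add: add_nonneg_pos sum_nonneg)
      \<comment> \<open>Diagonal entries below \<^term>\<open>r\<close> cannot outweigh the negative term at \<^term>\<open>i0\<close>.\<close>
      define r where "r = s u * \<bar>x i0\<bar> / N"
      have r: "r > 0" unfolding r_def using u N neg by (intro divide_pos_pos mult_pos_pos) auto
      have "infinite (E - {e \<in> E. r \<le> s e} - {u})"
        using onb_infinite[OF E assms(1)] finite_large_terms[OF s_summable s_nonneg r]
        by (metis Diff_infinite_finite finite.emptyI finite.insertI)
      then obtain v :: "nat \<Rightarrow> 'h" where v: "inj v" "range v \<subseteq> E - {e \<in> E. r \<le> s e} - {u}"
        using infinite_countable_subset by blast
      have vE: "v j \<in> E" "v j \<noteq> u" "s (v j) < r" for j using v(2) by (auto simp: subset_iff not_le)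
      define w where "w = v(i0 := u)"
      have wE: "w j \<in> E" for j unfolding w_def using vE u by simp
      have w_inj: "w i = w j \<longleftrightarrow> i = j" for i j
        unfolding w_def using v(1) vE(2) by (auto simp: inj_eq)
      interpret orthonormal_family w k
      proof
        show "cinner (w i) (w j) = (if i = j then 1 else 0)" if "i < k" "j < k" for i j
          using orth[OF wE wE] by (simp add: w_inj)
        \<comment> \<open>The vector that \<^term>\<open>u\<close> has replaced is orthogonal to the whole family.\<close>
        have "v i0 \<noteq> 0" using orth[OF vE(1)[of i0] vE(1)[of i0]] by auto
        moreover have "cinner (w i) (v i0) = 0" for i
          using orth[OF wE vE(1)[of i0]] v(1) vE(2) unfolding w_def by (auto simp: inj_eq)
        ultimately show "\<exists>u. u \<noteq> 0 \<and> (\<forall>i<k. cinner (w i) u = 0)" by blast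
      qed
      have "0 \<le> Re (compressed_trace S (udiag k (?Q' * U) (\<lambda>i. sqrt (f (a i)))
          * udiag k (?Q' * V) (\<lambda>i. g (b i)) * udiag k (?Q' * U) (\<lambda>i. sqrt (f (a i)))
          - udiag k (?Q' * U) a))"
      proof (rule compressed_trace_inequality[OF E[unfolded E_def] _ S summable[unfolded E_def] \<phi> f g ineq
            unitary_mat_mult[OF Q' U] unitary_mat_mult[OF Q' V] a b])
        show "w ` {..<k} \<subseteq> (SOME E. is_onb E)" using wE unfolding E_def by blast
        fix y :: "complex vec" assume y: "y \<in> carrier_vec k"
        have "udiag k (?Q' * V) b - udiag k (?Q' * U) a = ?Q' * (B - A) * Q"
          unfolding conj[OF U] conj[OF V] A[symmetric] B[symmetric]
          using carr Qs by (intro conj_minus[symmetric]) auto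
        hence "((udiag k (?Q' * V) b - udiag k (?Q' * U) a) *\<^sub>v y) \<bullet>c y
            = ((B - A) *\<^sub>v (Q *\<^sub>v y)) \<bullet>c (Q *\<^sub>v y)"
          using conj_quadratic_form[of "B - A" k Q y] carr Qs(1) y by (simp add: minus_carrier_mat)
        also have "\<dots> \<ge> 0" using AB Qs(1) y unfolding mat_le_def by simp
        finally show "0 \<le> ((udiag k (?Q' * V) b - udiag k (?Q' * U) a) *\<^sub>v y) \<bullet>c y" .
      qed
      also have "udiag k (?Q' * U) (\<lambda>i. sqrt (f (a i)))
          * udiag k (?Q' * V) (\<lambda>i. g (b i)) * udiag k (?Q' * U) (\<lambda>i. sqrt (f (a i)))
          - udiag k (?Q' * U) a = ?Q' * X * Q"
        unfolding conj[OF U] conj[OF V] A[symmetric] B[symmetric] C_def[symmetric] G_def[symmetric]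
          X_def using carr Qs(1,2) Q
        by (simp only: unitary_conj_mult square_mat_mult_carrier conj_minus[of _ k])
      also have "\<dots> = mat_diag k (\<lambda>i. complex_of_real (x i))"
        unfolding X by (rule udiag_conj_self[OF Q])
      finally have "0 \<le> (\<Sum>i<k. x i * s (w i))"
        unfolding compressed_trace_diag[OF S] s by simp
      also have "\<dots> = x i0 * s u + (\<Sum>i\<in>{..<k} - {i0}. x i * s (w i))"
        using i0 by (subst sum.remove[of _ i0]) (auto simp: w_def)
      also have "(\<Sum>i\<in>{..<k} - {i0}. x i * s (w i)) \<le> (\<Sum>i\<in>{..<k} - {i0}. \<bar>x i\<bar> * r)"
      proof (rule sum_mono)
        fix i assume "i \<in> {..<k} - {i0}"
        hence "0 \<le> s (w i)" "s (w i) \<le> r" using vE(3)[of i] s_nonneg by (auto simp: w_def)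
        thus "x i * s (w i) \<le> \<bar>x i\<bar> * r" by (meson abs_ge_self abs_ge_zero mult_mono)
      qed
      also have "\<dots> \<le> (\<Sum>i<k. \<bar>x i\<bar> * r)" using r by (intro sum_mono2) auto
      also have "\<dots> < N * r" unfolding N_def using r by (simp add: sum_distrib_right[symmetric] distrib_right)
      also have "N * r = - (x i0 * s u)" unfolding r_def using N neg by simp
      finally show False by simp
    qed

    \<comment> \<open>Undoing the multiplication by \<open>f(A)\<^sup>1\<^sup>/\<^sup>2\<close> turns positivity of \<^term>\<open>X\<close> into the claim.\<close>
    have C'C: "C' * C = 1\<^sub>m k" "C * C' = 1\<^sub>m k"
    proof -
      have "sqrt (f (a i)) \<noteq> 0" if "i < k" for i using f[OF a[OF that]] by simp
      thus "C' * C = 1\<^sub>m k" "C * C' = 1\<^sub>m k"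
        unfolding C'_def C_def udiag_mult[OF U] udiag_one[OF U, symmetric]
        by (auto intro!: udiag_cong)
    qed
    have C'AC': "C' * A * C' = udiag k U (\<lambda>i. g (a i))"
      unfolding C'_def A udiag_mult[OF U]
    proof (rule udiag_cong)
      fix i assume "i < k"
      hence "f (a i) > 0" "g (a i) = a i / f (a i)" using f g a by auto
      moreover have "1 / sqrt (f (a i)) * a i * (1 / sqrt (f (a i)))
          = a i / (sqrt (f (a i)) * sqrt (f (a i)))" by simp
      ultimately show "1 / sqrt (f (a i)) * a i * (1 / sqrt (f (a i))) = g (a i)" by simp
    qed
    have "C' * (C * G * C) * C' = (C' * C) * G * (C * C')"
      using carr by (simp add: assoc_mult_mat[of _ k k _ k _ k])
    also have "\<dots> = G" using C'C carr by simp
    finally have C'XC': "C' * X * C' = G - udiag k U (\<lambda>i. g (a i))"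
      unfolding X_def using carr by (subst conj_minus[of _ k]) (auto simp: C'AC')
    have "0 \<le> ((G - udiag k U (\<lambda>i. g (a i))) *\<^sub>v v) \<bullet>c v" if v: "v \<in> carrier_vec k" for v
    proof -
      have adj: "mat_adjoint C' = C'" unfolding C'_def by (rule udiag_adjoint[OF U])
      have "((G - udiag k U (\<lambda>i. g (a i))) *\<^sub>v v) \<bullet>c v = (X *\<^sub>v (C' *\<^sub>v v)) \<bullet>c (C' *\<^sub>v v)"
        using conj_quadratic_form[OF carr(6) carr(4) v] unfolding adj C'XC' .
      also have "\<dots> \<ge> 0"
        unfolding X using carr v by (intro udiag_psd[OF Q] x_nonneg) auto
      finally show ?thesis .
    qed
    thus "mat_le k (mat_fun k g A) (mat_fun k g B)"
      unfolding mat_le_def A B mat_fun_udiag[OF U] mat_fun_udiag[OF V] using U V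
      by (simp add: G_def)
  qed
qed

end
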